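(* Let $\ell\ge 2$ be a constant integer and let $q=q(n)\in(0,1)$ be such that $1-q=o(1)$ and $(1-q)n/\ln n\to\infty$ as $n\to\infty$. Let $\Pi_n\sim\mathrm{Mallows}(n,q)$. Then $$\mathbb{E}\,\mathrm{Arr}_{\mathbf{S}_\ell}(\Pi_n)=(1+o(1))\,\frac{\ell!\,[(\ell-1)!]^2}{(2\ell-1)!}\,n(1-q)^{\ell-1}.$$
   Context: All asymptotics are as $n\to\infty$. $[t]=\{1,\ldots,t\}$ and $\mathbf{S}_t$ is the set of permutations of $[t]$. Mallows distribution: $\mathrm{Mallows}(n,q)$ is the law of a random permutation $\Pi_n\in\mathbf{S}_n$ with $\mathbb{P}(\Pi_n=\sigma)=q^{\mathrm{inv}(\sigma)}/\sum_{\pi\in\mathbf{S}_n}q^{\mathrm{inv}(\pi)}$, where $\mathrm{inv}(\sigma)=|\{(i,j):1\le i<j\le n,\ \sigma(i)>\sigma(j)\}|$. $\mathcal{S}$-arrangements: for $\emptyset\ne\mathcal{S}\subseteq\mathbf{S}_\ell$, $n\ge\ell$ and $0\le k_1,k_2\le n-\ell$, there is an $(\mathcal{S},k_1,k_2)$-arrangement in a permutation $\Pi_n\in\mathbf{S}_n$ if there is $\sigma\in\mathcal{S}$ with $\Pi_n(k_2+i)=k_1+\sigma(i)$ for all $i\in[\ell]$. $\mathrm{Arr}_{\mathcal{S}}(\Pi_n)$ is the number of pairs $(k_1,k_2)$ such that there is an $(\mathcal{S},k_1,k_2)$-arrangement in $\Pi_n$; here $\mathcal{S}=\mathbf{S}_\ell$.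 *)

theory Defs
  imports
    "HOL-Probability.Probability"
    "HOL-Combinatorics.Permutations"
    "HOL-Library.Landau_Symbols"
begin

definition Perms :: "nat \<Rightarrow> (nat \<Rightarrow> nat) set" where
  "Perms t = {\<sigma>. \<sigma> permutes {1..t}}"

definition inv_count :: "nat \<Rightarrow> (nat \<Rightarrow> nat) \<Rightarrow> nat" where
  "inv_count n \<sigma> = card {(i, j). 1 \<le> i \<and> i < j \<and> j \<le> n \<and> \<sigma> i > \<sigma> j}"

definition mallows_weight :: "nat \<Rightarrow> real \<Rightarrow> (nat \<Rightarrow> nat) \<Rightarrow> real" where
  "mallows_weight n q \<sigma> =
     (if \<sigma> \<in> Perms n
      then q ^ inv_count n \<sigma> / (\<Sum>\<pi>\<in>Perms n. q ^ inv_count n \<pi>)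
      else 0)"

text \<open>
  The value of \<open>embed_pmf\<close> is meaningful only for nonnegative weights of total mass one;
  lemma \<open>pmf_mallows\<close> confirms this whenever \<open>q > 0\<close>.
\<close>

definition mallows :: "nat \<Rightarrow> real \<Rightarrow> (nat \<Rightarrow> nat) pmf" where
  "mallows n q = embed_pmf (mallows_weight n q)"

lemma finite_Perms: "finite (Perms n)"
  unfolding Perms_def by (rule finite_permutations) simp

lemma pmf_mallows:
  assumes "q > 0"
  shows "pmf (mallows n q) \<sigma> = mallows_weight n q \<sigma>"
proof -
  have "id \<in> Perms n"
    by (simp add: Perms_def permutes_id)
  then have Z: "(\<Sum>\<pi>\<in>Perms n. q ^ inv_count n \<pi>) > 0"
    using assms finite_Perms by (intro sum_pos) auto
  have nonneg: "mallows_weight n q \<pi> \<ge> 0" for \<pi>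
    using assms Z by (simp add: mallows_weight_def)
  have "(\<integral>\<^sup>+\<pi>. ennreal (mallows_weight n q \<pi>) \<partial>count_space UNIV)
      = (\<Sum>\<pi>\<in>Perms n. ennreal (mallows_weight n q \<pi>))"
    by (rule nn_integral_count_space') (auto simp: finite_Perms mallows_weight_def)
  also have "\<dots> = ennreal (\<Sum>\<pi>\<in>Perms n. mallows_weight n q \<pi>)"
    by (simp add: nonneg)
  also have "(\<Sum>\<pi>\<in>Perms n. mallows_weight n q \<pi>) = 1"
    using Z by (simp add: mallows_weight_def flip: sum_divide_distrib)
  finally show ?thesis
    unfolding mallows_def using nonneg by (subst pmf_embed_pmf) auto
qed

definition has_arrangement ::
  "nat \<Rightarrow> (nat \<Rightarrow> nat) set \<Rightarrow> nat \<Rightarrow> nat \<Rightarrow> (nat \<Rightarrow> nat) \<Rightarrow> bool" where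
  "has_arrangement l S k1 k2 \<pi> \<longleftrightarrow> (\<exists>\<sigma>\<in>S. \<forall>i\<in>{1..l}. \<pi> (k2 + i) = k1 + \<sigma> i)"

text \<open>
  The range \<open>0 \<le> k \<le> n - l\<close> is written \<open>k + l \<le> n\<close> to avoid truncated subtraction:
  there are no admissible pairs when \<open>n < l\<close>.
\<close>

definition Arr :: "nat \<Rightarrow> nat \<Rightarrow> (nat \<Rightarrow> nat) set \<Rightarrow> (nat \<Rightarrow> nat) \<Rightarrow> nat" where
  "Arr n l S \<pi> = card {(k1, k2). k1 + l \<le> n \<and> k2 + l \<le> n \<and> has_arrangement l S k1 k2 \<pi>}"

end

theory Submission
  imports
    Defs
    "HOL-Combinatorics.Multiset_Permutations"
    "HOL-Real_Asymp.Real_Asymp"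
begin

text \<open>
  Write \<open>(q)\<^sub>i\<close> for the product of \<open>1 - q^t\<close> over \<open>1 \<le> t \<le> i\<close>, and fix the window of positions
  \<open>k + 1, \<dots>, k + l\<close>, with \<open>j = n - l - k\<close> positions to its right. A permutation that maps this window
  onto an interval \<open>J\<close> of values is determined by the set of values placed to the left of the window
  and by three independent orderings, and its inversions are the sum of the corresponding
  contributions. If \<open>a\<close> values above \<open>J\<close> are placed to the left and \<open>b\<close> values below \<open>J\<close> to the right, then
  \<open>a b + l (a + b)\<close> inversions are forced, and the rest is counted by \<open>q\<close>-factorials and \<open>q\<close>-binomial
  coefficients. Summing over \<open>J\<close> expresses the expected number of arrangements at the window as a
  finite double sum over \<open>a \<le> k\<close> and \<open>b \<le> j\<close> (lemmas \<open>window_weight_eq\<close> and \<open>sum_window_weight\<close>).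

  Far from both ends the summand is close to
  \<open>(q)\<^sub>l (q)\<^sub>\<infinity> q^(a b + l (a + b)) / ((q)\<^sub>a (q)\<^sub>b)\<close>, and summing this over all \<open>a\<close> and \<open>b\<close> takes two applications
  of the \<open>q\<close>-binomial theorem. The result is the exact bulk value
  \<open>(q)\<^sub>l ((q)\<^sub>l\<^sub>-\<^sub>1)^2 / (q)\<^sub>2\<^sub>l\<^sub>-\<^sub>1\<close>, which is \<open>(1 - q)^(l - 1)\<close> times a quotient of \<open>q\<close>-factorials. As \<open>q\<close> tends
  to one the \<open>q\<close>-factorials become factorials, and this is where the constant of the theorem comes from.

  The infinite product is avoided by extending only the sum over \<open>b\<close> to infinity: every \<open>q\<close>-binomial
  sum then has a closed form with finite products (\<open>sums_position_term_inner\<close>,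
  \<open>sums_position_term_outer\<close>), and the error is controlled by \<open>q^K / (1 - q)\<close>, where \<open>K\<close> is a lower bound for
  the distance to the ends (\<open>sum_position_term_le\<close>, \<open>sum_position_term_ge\<close>). Windows near an end contribute
  at most \<open>2 l! (1 - q)^(l - 1)\<close> each (\<open>position_mean_le_uniform\<close>), the same order as a window in the
  bulk. With \<open>K\<close> about \<open>2 ln n / (1 - q)\<close>, the hypothesis on \<open>(1 - q) n / ln n\<close> says precisely that \<open>K = o(n)\<close>,
  so the windows near an end are negligible, while \<open>q^K / (1 - q) \<le> 1 / n\<close> makes the error in the bulk
  vanish.
\<close>

section \<open>Inversions of lists\<close>

fun inversions :: "'a::linorder list \<Rightarrow> nat" where
  "inversions [] = 0"
| "inversions (x # xs) = card {y \<in> set xs. y < x} + inversions xs"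

text \<open>
  Inversions between two blocks of a list depend only on the sets of entries of the blocks, which is
  why they are counted for sets.
\<close>

definition cross_inv :: "'a::linorder set \<Rightarrow> 'a set \<Rightarrow> nat" where
  "cross_inv X Y = card {(x, y). x \<in> X \<and> y \<in> Y \<and> y < x}"

lemma cross_inv_empty_left [simp]: "cross_inv {} Y = 0"
  by (simp add: cross_inv_def)

lemma cross_inv_Un_left:
  assumes "finite X" "finite X'" "finite Y" "X \<inter> X' = {}"
  shows "cross_inv (X \<union> X') Y = cross_inv X Y + cross_inv X' Y"
proof -
  have "card ({(x, y). x \<in> X \<and> y \<in> Y \<and> y < x} \<union> {(x, y). x \<in> X' \<and> y \<in> Y \<and> y < x}) =
      cross_inv X Y + cross_inv X' Y"
    unfolding cross_inv_def using assms
    by (intro card_Un_disjoint)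
       (auto intro: finite_subset[of _ "X \<times> Y"] finite_subset[of _ "X' \<times> Y"])
  moreover have "{(x, y). x \<in> X \<union> X' \<and> y \<in> Y \<and> y < x} =
      {(x, y). x \<in> X \<and> y \<in> Y \<and> y < x} \<union> {(x, y). x \<in> X' \<and> y \<in> Y \<and> y < x}"
    by auto
  ultimately show ?thesis
    by (simp add: cross_inv_def)
qed

lemma cross_inv_Un_right:
  assumes "finite X" "finite Y" "finite Y'" "Y \<inter> Y' = {}"
  shows "cross_inv X (Y \<union> Y') = cross_inv X Y + cross_inv X Y'"
proof -
  have "card ({(x, y). x \<in> X \<and> y \<in> Y \<and> y < x} \<union> {(x, y). x \<in> X \<and> y \<in> Y' \<and> y < x}) =
      cross_inv X Y + cross_inv X Y'"
    unfolding cross_inv_def using assms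
    by (intro card_Un_disjoint)
       (auto intro: finite_subset[of _ "X \<times> Y"] finite_subset[of _ "X \<times> Y'"])
  moreover have "{(x, y). x \<in> X \<and> y \<in> Y \<union> Y' \<and> y < x} =
      {(x, y). x \<in> X \<and> y \<in> Y \<and> y < x} \<union> {(x, y). x \<in> X \<and> y \<in> Y' \<and> y < x}"
    by auto
  ultimately show ?thesis
    by (simp add: cross_inv_def)
qed

lemma cross_inv_less:
  assumes "\<And>x y. x \<in> X \<Longrightarrow> y \<in> Y \<Longrightarrow> x < y"
  shows "cross_inv X Y = 0"
proof -
  have "{(x, y). x \<in> X \<and> y \<in> Y \<and> y < x} = {}"
    using assms by fastforce
  then show ?thesis unfolding cross_inv_def by (simp only: card.empty)
qed

lemma cross_inv_greater:
  assumes "\<And>x y. x \<in> X \<Longrightarrow> y \<in> Y \<Longrightarrow> y < x"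
  shows "cross_inv X Y = card X * card Y"
proof -
  have "{(x, y). x \<in> X \<and> y \<in> Y \<and> y < x} = X \<times> Y"
    using assms by fastforce
  then show ?thesis unfolding cross_inv_def by (simp add: card_cartesian_product)
qed

lemma cross_inv_singleton: "cross_inv {x} Y = card {y \<in> Y. y < x}"
proof -
  have "{(x', y). x' \<in> {x} \<and> y \<in> Y \<and> y < x'} = Pair x ` {y \<in> Y. y < x}"
    by auto
  moreover have "card (Pair x ` {y \<in> Y. y < x}) = card {y \<in> Y. y < x}"
    by (intro card_image) (simp add: inj_on_def)
  ultimately show ?thesis unfolding cross_inv_def by (simp only:)
qed

lemma inversions_append:
  assumes "distinct (xs @ ys)"
  shows "inversions (xs @ ys) = inversions xs + inversions ys + cross_inv (set xs) (set ys)"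
  using assms
proof (induction xs)
  case (Cons x xs)
  have "{y \<in> set (xs @ ys). y < x} = {y \<in> set xs. y < x} \<union> {y \<in> set ys. y < x}"
    by auto
  moreover have "{y \<in> set xs. y < x} \<inter> {y \<in> set ys. y < x} = {}"
    using Cons.prems by auto
  ultimately have "card {y \<in> set (xs @ ys). y < x} = card {y \<in> set xs. y < x} + cross_inv {x} (set ys)"
    by (simp add: card_Un_disjoint cross_inv_singleton)
  moreover have "cross_inv (set (x # xs)) (set ys) = cross_inv {x} (set ys) + cross_inv (set xs) (set ys)"
    using Cons.prems cross_inv_Un_left[of "{x}" "set xs" "set ys"] by simp
  ultimately show ?case using Cons by simp
qed simp

section \<open>Generating functions of inversions\<close>

text \<open>
  The \<open>q\<close>-Pochhammer symbol \<open>(q; q)\<^sub>n\<close>.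
\<close>

definition qpoch :: "real \<Rightarrow> nat \<Rightarrow> real" where
  "qpoch q n = (\<Prod>i = 1..n. 1 - q ^ i)"

lemma qpoch_0 [simp]: "qpoch q 0 = 1"
  by (simp add: qpoch_def)

lemma qpoch_Suc: "qpoch q (Suc n) = qpoch q n * (1 - q ^ Suc n)"
  by (simp add: qpoch_def)

text \<open>
  The \<open>q\<close>-factorial \<open>[n]\<^sub>q!\<close>, that is, the product of \<open>1 + q + \<dots> + q^(t - 1)\<close> over \<open>1 \<le> t \<le> n\<close>.
\<close>

definition qfact :: "real \<Rightarrow> nat \<Rightarrow> real" where
  "qfact q n = qpoch q n / (1 - q) ^ n"

lemma qpoch_pos: "0 < q \<Longrightarrow> q < 1 \<Longrightarrow> 0 < qpoch q n"
  unfolding qpoch_def by (intro prod_pos) (auto simp: power_less_one_iff)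

lemma qfact_pos: "0 < q \<Longrightarrow> q < 1 \<Longrightarrow> 0 < qfact q n"
  by (simp add: qfact_def qpoch_pos)

text \<open>
  Cutting a list after its first entries separates the two orderings completely: given the set \<open>X\<close>
  of entries of the prefix, the prefix and the rest range independently over the orderings of \<open>X\<close> and
  of \<open>A - X\<close>, and the inversions between them are fixed. The predicate \<open>Q\<close> allows a second cut to be
  made in the rest.
\<close>

lemma sum_permutations_prefix:
  fixes q :: real
  assumes "finite A" "X \<subseteq> A"
  shows "(\<Sum>zs \<in> {zs \<in> permutations_of_set A. set (take (card X) zs) = X \<and> Q (drop (card X) zs)}.
            q ^ inversions zs) =
         q ^ cross_inv X (A - X) * (\<Sum>xs \<in> permutations_of_set X. q ^ inversions xs) *
         (\<Sum>ys \<in> {ys \<in> permutations_of_set (A - X). Q ys}. q ^ inversions ys)"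
proof -
  have drop_eq: "set (drop (card X) zs) = A - X"
    if "set zs = A" "distinct zs" "set (take (card X) zs) = X" for zs
  proof -
    have "set zs = set (take (card X) zs) \<union> set (drop (card X) zs)"
      by (metis append_take_drop_id set_append)
    moreover have "set (take (card X) zs) \<inter> set (drop (card X) zs) = {}"
      using that(2) by (simp add: set_take_disj_set_drop_if_distinct)
    ultimately show ?thesis unfolding that(1,3) by blast
  qed
  have "(\<Sum>zs \<in> {zs \<in> permutations_of_set A. set (take (card X) zs) = X \<and> Q (drop (card X) zs)}.
            q ^ inversions zs) =
        (\<Sum>(xs, ys) \<in> permutations_of_set X \<times> {ys \<in> permutations_of_set (A - X). Q ys}.
            q ^ cross_inv X (A - X) * q ^ inversions xs * q ^ inversions ys)"
  proof (rule sum.reindex_bij_witness[of _ "\<lambda>(xs, ys). xs @ ys" "\<lambda>zs. (take (card X) zs, drop (card X) zs)"],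
      goal_cases)
    case (1 zs)
    then show ?case by simp
  next
    case (2 zs)
    then have zs: "set zs = A" "distinct zs" and X: "set (take (card X) zs) = X"
      and Q: "Q (drop (card X) zs)"
      by (simp_all add: permutations_of_set_def)
    have "set (drop (card X) zs) = A - X"
      using drop_eq[OF zs X] .
    then show ?case using zs X Q by (simp add: permutations_of_set_def)
  next
    case (3 xys)
    then show ?case
      by (auto simp: permutations_of_set_def distinct_card)
  next
    case (4 xys)
    then show ?case using assms
      by (auto simp: permutations_of_set_def distinct_card)
  next
    case (5 zs)
    then have zs: "set zs = A" "distinct zs" and X: "set (take (card X) zs) = X"
      by (simp_all add: permutations_of_set_def)
    have "inversions zs = inversions (take (card X) zs) + inversions (drop (card X) zs) + cross_inv X (A - X)"
      using inversions_append[of "take (card X) zs" "drop (card X) zs"] zs(2)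
      by (simp only: append_take_drop_id X drop_eq[OF zs X])
    then show ?case by (simp add: power_add)
  qed
  also have "\<dots> = q ^ cross_inv X (A - X) * (\<Sum>xs \<in> permutations_of_set X. q ^ inversions xs) *
         (\<Sum>ys \<in> {ys \<in> permutations_of_set (A - X). Q ys}. q ^ inversions ys)"
    by (simp only: sum.cartesian_product[symmetric] mult.assoc, simp only: sum_product,
        simp only: sum_distrib_left)
  finally show ?thesis .
qed

lemma sum_permutations_by_prefix:
  fixes q :: real
  assumes "finite A" "k \<le> card A"
  shows "(\<Sum>zs \<in> {zs \<in> permutations_of_set A. Q (drop k zs)}. q ^ inversions zs) =
         (\<Sum>X | X \<subseteq> A \<and> card X = k.
           q ^ cross_inv X (A - X) * (\<Sum>xs \<in> permutations_of_set X. q ^ inversions xs) *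
           (\<Sum>ys \<in> {ys \<in> permutations_of_set (A - X). Q ys}. q ^ inversions ys))"
proof -
  let ?S = "{zs \<in> permutations_of_set A. Q (drop k zs)}"
  have "(\<Sum>zs \<in> ?S. q ^ inversions zs) =
      (\<Sum>X \<in> {X. X \<subseteq> A \<and> card X = k}. \<Sum>zs \<in> {zs \<in> ?S. set (take k zs) = X}. q ^ inversions zs)"
  proof (rule sum.group[symmetric])
    show "(\<lambda>zs. set (take k zs)) ` ?S \<subseteq> {X. X \<subseteq> A \<and> card X = k}"
    proof safe
      fix zs x assume "zs \<in> permutations_of_set A"
      then have zs: "set zs = A" "distinct zs" by (auto simp: permutations_of_set_def)
      then show "x \<in> set (take k zs) \<Longrightarrow> x \<in> A" using set_take_subset by fastforce
      have "length zs = card A" using zs distinct_card by metis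
      then show "card (set (take k zs)) = k" using zs assms
        by (simp add: distinct_card)
    qed
  qed (use assms in auto)
  also have "\<dots> = (\<Sum>X | X \<subseteq> A \<and> card X = k.
           q ^ cross_inv X (A - X) * (\<Sum>xs \<in> permutations_of_set X. q ^ inversions xs) *
           (\<Sum>ys \<in> {ys \<in> permutations_of_set (A - X). Q ys}. q ^ inversions ys))"
  proof (rule sum.cong[OF refl], goal_cases)
    case (1 X)
    then show ?case
      using sum_permutations_prefix[OF assms(1), of X q Q]
      by (auto simp: conj_ac intro!: arg_cong2[where f=sum])
  qed
  finally show ?thesis .
qed

text \<open>
  The sum runs over the possible first entries of a list: the first entry is inverted with every
  smaller entry, and the ranks of the elements of \<open>A\<close> are \<open>0, \<dots>, card A - 1\<close>.
\<close>

lemma sum_power_rank: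
  fixes q :: real and A :: "'a::linorder set"
  assumes "finite A"
  shows "(\<Sum>x\<in>A. q ^ card {y \<in> A. y < x}) = (\<Sum>i < card A. q ^ i)"
  using assms
proof (induction A rule: finite_linorder_max_induct)
  case (insert b A)
  have "(\<Sum>x\<in>A. q ^ card {y \<in> insert b A. y < x}) = (\<Sum>x\<in>A. q ^ card {y \<in> A. y < x})"
    using insert by (intro sum.cong refl arg_cong2[where f=power] arg_cong[where f=card]) fastforce
  moreover have "{y \<in> insert b A. y < b} = A" using insert by auto
  moreover have "b \<notin> A" using insert by auto
  ultimately show ?case using insert by simp
qed simp

lemma sum_inversions_permutations:
  fixes q :: real and A :: "'a::linorder set"
  assumes "finite A" "q \<noteq> 1"
  shows "(\<Sum>xs \<in> permutations_of_set A. q ^ inversions xs) = qfact q (card A)"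
  using assms(1)
proof (induction "card A" arbitrary: A)
  case 0
  then show ?case by (simp add: qfact_def)
next
  case (Suc n)
  have "(\<Sum>xs \<in> permutations_of_set A. q ^ inversions xs) =
        (\<Sum>X | X \<subseteq> A \<and> card X = 1.
           q ^ cross_inv X (A - X) * (\<Sum>xs \<in> permutations_of_set X. q ^ inversions xs) *
           (\<Sum>ys \<in> permutations_of_set (A - X). q ^ inversions ys))"
    using sum_permutations_by_prefix[of A 1 q "\<lambda>_. True"] Suc by simp
  also have "\<dots> = (\<Sum>x\<in>A. q ^ card {y \<in> A. y < x} * qfact q n)"
  proof (rule sum.reindex_bij_witness[of _ "\<lambda>x. {x}" "the_elem"], goal_cases)
    case (5 X)
    then obtain x where x: "X = {x}" "x \<in> A" by (auto simp: card_1_singleton_iff)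
    have "(\<Sum>ys \<in> permutations_of_set (A - {x}). q ^ inversions ys) = qfact q (card (A - {x}))"
      using Suc x by (intro Suc) auto
    moreover have "card (A - {x}) = n" using Suc x by simp
    moreover have "{y \<in> A - {x}. y < x} = {y \<in> A. y < x}" by auto
    ultimately show ?case using x by (simp add: cross_inv_singleton)
  qed (auto simp: card_1_singleton_iff)
  also have "\<dots> = (\<Sum>i < Suc n. q ^ i) * qfact q n"
    using sum_power_rank[OF Suc.prems, of q] Suc.hyps by (simp flip: sum_distrib_right)
  also have "\<dots> = qfact q (Suc n)"
    using assms(2) by (subst sum_gp_strict) (simp add: qfact_def qpoch_Suc mult_ac)
  finally show ?case using Suc by simp
qed

text \<open>
  The right-hand side is a \<open>q\<close>-binomial coefficient. It needs no recurrence: cutting all orderings of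
  \<open>A\<close> after \<open>k\<close> entries writes \<open>[card A]\<^sub>q!\<close> as the sum on the left times
  \<open>[k]\<^sub>q! [card A - k]\<^sub>q!\<close>.
\<close>

lemma sum_cross_inv_subsets:
  fixes q :: real and A :: "'a::linorder set"
  assumes "finite A" "0 < q" "q < 1" "k \<le> card A"
  shows "(\<Sum>X | X \<subseteq> A \<and> card X = k. q ^ cross_inv X (A - X)) =
         qfact q (card A) / (qfact q k * qfact q (card A - k))"
proof -
  have "qfact q (card A) = (\<Sum>X | X \<subseteq> A \<and> card X = k.
           q ^ cross_inv X (A - X) * (\<Sum>xs \<in> permutations_of_set X. q ^ inversions xs) *
           (\<Sum>ys \<in> permutations_of_set (A - X). q ^ inversions ys))"
    using sum_permutations_by_prefix[of A k q "\<lambda>_. True"] assms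
    by (simp add: sum_inversions_permutations)
  also have "\<dots> = (\<Sum>X | X \<subseteq> A \<and> card X = k. q ^ cross_inv X (A - X) * (qfact q k * qfact q (card A - k)))"
    using assms
    by (intro sum.cong refl)
       (auto simp: sum_inversions_permutations card_Diff_subset finite_subset)
  finally show ?thesis
    using qfact_pos[OF assms(2,3)] by (simp add: sum_distrib_right[symmetric] less_imp_neq[symmetric])
qed

section \<open>Arrangements as windows of a list\<close>

text \<open>
  By induction on \<open>n\<close>, removing the last position: the inversions that end there are counted by the
  values before it that exceed its value.
\<close>

lemma inv_count_eq_inversions:
  assumes "inj_on \<pi> {1..n}"
  shows "inv_count n \<pi> = inversions (map \<pi> [1..<Suc n])"
  using assms
proof (induction n)
  case 0
  have "{(i::nat, j). 1 \<le> i \<and> i < j \<and> j \<le> 0 \<and> \<pi> i > \<pi> j} = {}" by auto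
  then show ?case unfolding inv_count_def by (simp only: card.empty) simp
next
  case (Suc n)
  have inj: "inj_on \<pi> {1..n}" "\<pi> (Suc n) \<notin> \<pi> ` {1..n}"
    using Suc.prems unfolding inj_on_def by (simp, force)
  let ?I = "{i \<in> {1..n}. \<pi> (Suc n) < \<pi> i}"
  have "inv_count (Suc n) \<pi> = card ({(i, j). 1 \<le> i \<and> i < j \<and> j \<le> n \<and> \<pi> i > \<pi> j} \<union> (\<lambda>i. (i, Suc n)) ` ?I)"
    unfolding inv_count_def
  proof (intro arg_cong[where f = card] set_eqI)
    fix x :: "nat \<times> nat"
    obtain i j where x: "x = (i, j)" by (cases x)
    show "x \<in> {(i, j). 1 \<le> i \<and> i < j \<and> j \<le> Suc n \<and> \<pi> i > \<pi> j} \<longleftrightarrow>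
        x \<in> {(i, j). 1 \<le> i \<and> i < j \<and> j \<le> n \<and> \<pi> i > \<pi> j} \<union> (\<lambda>i. (i, Suc n)) ` ?I"
      unfolding x by (cases "j = Suc n") auto
  qed
  also have "\<dots> = inv_count n \<pi> + card ((\<lambda>i. (i, Suc n)) ` ?I)"
    unfolding inv_count_def
    by (rule card_Un_disjoint) (auto intro: finite_subset[of _ "{1..n} \<times> {1..n}"])
  also have "card ((\<lambda>i. (i, Suc n)) ` ?I) = card ?I"
    by (rule card_image) (simp add: inj_on_def)
  also have "card ?I = cross_inv (\<pi> ` {1..n}) {\<pi> (Suc n)}"
  proof -
    have "{(x, y). x \<in> \<pi> ` {1..n} \<and> y \<in> {\<pi> (Suc n)} \<and> y < x} = (\<lambda>i. (\<pi> i, \<pi> (Suc n))) ` ?I"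
      by auto
    moreover have "inj_on (\<lambda>i. (\<pi> i, \<pi> (Suc n))) ?I"
      using inj(1) unfolding inj_on_def by blast
    ultimately show ?thesis
      unfolding cross_inv_def by (simp only: card_image)
  qed
  also have "inv_count n \<pi> + cross_inv (\<pi> ` {1..n}) {\<pi> (Suc n)} =
      inversions (map \<pi> [1..<Suc n] @ [\<pi> (Suc n)])"
  proof -
    have s: "set (map \<pi> [1..<Suc n]) = \<pi> ` {1..n}"
      by (simp only: set_map set_upt atLeastLessThanSuc_atLeastAtMost)
    have "distinct (map \<pi> [1..<Suc n])"
      using inj(1) by (simp only: distinct_map distinct_upt set_upt atLeastLessThanSuc_atLeastAtMost)
    then have "distinct (map \<pi> [1..<Suc n] @ [\<pi> (Suc n)])"
      unfolding distinct_append s using inj(2) by simp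
    from inversions_append[OF this] show ?thesis
      unfolding s Suc.IH[OF inj(1)] by simp
  qed
  also have "map \<pi> [1..<Suc n] @ [\<pi> (Suc n)] = map \<pi> [1..<Suc (Suc n)]"
    by simp
  finally show ?case .
qed

lemma bij_betw_Perms_permutations_of_set:
  "bij_betw (\<lambda>\<pi>. map \<pi> [1..<Suc n]) (Perms n) (permutations_of_set {1..n})"
proof (rule bij_betw_byWitness[where f' = "\<lambda>xs i. if i \<in> {1..n} then xs ! (i - 1) else i"])
  show "\<forall>\<pi>\<in>Perms n. (\<lambda>i. if i \<in> {1..n} then map \<pi> [1..<Suc n] ! (i - 1) else i) = \<pi>"
    by (auto simp: Perms_def permutes_def fun_eq_iff simp del: upt_Suc)
  show "\<forall>xs\<in>permutations_of_set {1..n}.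
      map (\<lambda>i. if i \<in> {1..n} then xs ! (i - 1) else i) [1..<Suc n] = xs"
    by (auto simp: length_finite_permutations_of_set intro!: nth_equalityI simp del: upt_Suc)
  show "(\<lambda>\<pi>. map \<pi> [1..<Suc n]) ` Perms n \<subseteq> permutations_of_set {1..n}"
  proof safe
    fix \<pi> assume "\<pi> \<in> Perms n"
    then have "\<pi> permutes {1..n}" by (simp add: Perms_def)
    then show "map \<pi> [1..<Suc n] \<in> permutations_of_set {1..n}"
      using permutes_inj_on[of \<pi> "{1..n}"] permutes_image[of \<pi> "{1..n}"]
      by (simp add: permutations_of_set_def distinct_map atLeastLessThanSuc_atLeastAtMost del: upt_Suc)
  qed
  show "(\<lambda>xs i. if i \<in> {1..n} then xs ! (i - 1) else i) ` permutations_of_set {1..n} \<subseteq> Perms n"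
  proof safe
    fix xs :: "nat list" assume xs: "xs \<in> permutations_of_set {1..n}"
    then have xs': "set xs = {1..n}" "distinct xs" "length xs = n"
      by (auto simp: permutations_of_set_def length_finite_permutations_of_set[OF xs])
    have "bij_betw (\<lambda>i. i - 1) {1..n} {..<n}"
      by (rule bij_betw_byWitness[where f' = Suc]) auto
    moreover have "bij_betw ((!) xs) {..<n} {1..n}"
      using bij_betw_nth[OF xs'(2) refl refl] xs' by simp
    ultimately have "bij_betw ((!) xs \<circ> (\<lambda>i. i - 1)) {1..n} {1..n}"
      by (rule bij_betw_trans)
    then have "bij_betw (\<lambda>i. if i \<in> {1..n} then xs ! (i - 1) else i) {1..n} {1..n}"
      by (subst bij_betw_cong[where g = "(!) xs \<circ> (\<lambda>i. i - 1)"]) simp_all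
    then show "(\<lambda>i. if i \<in> {1..n} then xs ! (i - 1) else i) \<in> Perms n"
      unfolding Perms_def by - (rule CollectI, erule bij_imp_permutes, rule if_not_P)
  qed
qed

text \<open>
  When every pattern is allowed, an arrangement only requires the window of positions to be mapped
  onto an interval of values, because the pattern can be read off from the permutation.
\<close>

lemma has_arrangement_Perms_iff:
  assumes "inj \<pi>"
  shows "has_arrangement l (Perms l) k1 k2 \<pi> \<longleftrightarrow> \<pi> ` {k2 + 1..k2 + l} = {k1 + 1..k1 + l}"
proof -
  have sh: "{k + 1..k + l} = (+) k ` {1..l}" for k :: nat
    by simp
  show ?thesis
  proof
    assume "has_arrangement l (Perms l) k1 k2 \<pi>"
    then obtain \<sigma> where \<sigma>: "\<sigma> permutes {1..l}" "\<forall>i\<in>{1..l}. \<pi> (k2 + i) = k1 + \<sigma> i"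
      by (auto simp: has_arrangement_def Perms_def)
    have "\<pi> ` {k2 + 1..k2 + l} = (\<lambda>i. \<pi> (k2 + i)) ` {1..l}"
      unfolding sh by (simp only: image_image)
    also have "\<dots> = (+) k1 ` \<sigma> ` {1..l}"
      unfolding image_image using \<sigma>(2) by (intro image_cong) auto
    also have "\<dots> = {k1 + 1..k1 + l}"
      unfolding permutes_image[OF \<sigma>(1)] sh ..
    finally show "\<pi> ` {k2 + 1..k2 + l} = {k1 + 1..k1 + l}" .
  next
    assume *: "\<pi> ` {k2 + 1..k2 + l} = {k1 + 1..k1 + l}"
    define \<sigma> where "\<sigma> = (\<lambda>i. if i \<in> {1..l} then \<pi> (k2 + i) - k1 else i)"
    have val: "\<pi> (k2 + i) \<in> {k1 + 1..k1 + l}" if "i \<in> {1..l}" for i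
    proof -
      have "k2 + i \<in> {k2 + 1..k2 + l}" using that by auto
      then have "\<pi> (k2 + i) \<in> \<pi> ` {k2 + 1..k2 + l}" by (rule imageI)
      then show ?thesis unfolding * .
    qed
    have eq: "\<forall>i\<in>{1..l}. \<pi> (k2 + i) = k1 + \<sigma> i"
    proof
      fix i assume i: "i \<in> {1..l}"
      with val[OF i] show "\<pi> (k2 + i) = k1 + \<sigma> i" by (simp add: \<sigma>_def)
    qed
    have "inj_on \<sigma> {1..l}"
    proof (rule inj_onI)
      fix i j assume "i \<in> {1..l}" "j \<in> {1..l}" "\<sigma> i = \<sigma> j"
      then have "\<pi> (k2 + i) = \<pi> (k2 + j)"
        by (simp only: eq[rule_format])
      from injD[OF assms this] show "i = j" by simp
    qed
    moreover have "\<sigma> ` {1..l} \<subseteq> {1..l}"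
    proof safe
      fix i assume i: "i \<in> {1..l}"
      from val[OF i] have "k1 + \<sigma> i \<in> {k1 + 1..k1 + l}"
        unfolding eq[rule_format, OF i] .
      then show "\<sigma> i \<in> {1..l}" by simp
    qed
    ultimately have "bij_betw \<sigma> {1..l} {1..l}"
      by (simp add: bij_betw_def endo_inj_surj)
    then have "\<sigma> permutes {1..l}"
      by (intro bij_imp_permutes) (auto simp: \<sigma>_def)
    with eq show "has_arrangement l (Perms l) k1 k2 \<pi>"
      by (auto simp: has_arrangement_def Perms_def)
  qed
qed

text \<open>
  The part of the partition function that comes from the permutations with an arrangement at
  \<open>(k1, k2)\<close>, written for lists of values.
\<close>

definition window_weight :: "real \<Rightarrow> nat \<Rightarrow> nat \<Rightarrow> nat \<Rightarrow> nat \<Rightarrow> real" where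
  "window_weight q n l k1 k2 =
     (\<Sum>zs \<in> {zs \<in> permutations_of_set {1..n}. set (take l (drop k2 zs)) = {k1 + 1..k1 + l}}.
        q ^ inversions zs)"

lemma sum_Perms_eq_window_weight:
  assumes "k2 + l \<le> n"
  shows "(\<Sum>\<pi> | \<pi> \<in> Perms n \<and> has_arrangement l (Perms l) k1 k2 \<pi>. q ^ inv_count n \<pi>) =
    window_weight q n l k1 k2"
proof -
  let ?f = "\<lambda>\<pi>. map \<pi> [1..<Suc n]"
  have set_eq: "set (take l (drop k2 (?f \<pi>))) = \<pi> ` {k2 + 1..k2 + l}" for \<pi> :: "nat \<Rightarrow> nat"
    using assms
    by (simp add: take_map drop_map drop_upt take_upt atLeastLessThanSuc_atLeastAtMost add.commute
        del: upt_Suc)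
  have "bij_betw ?f {\<pi> \<in> Perms n. has_arrangement l (Perms l) k1 k2 \<pi>}
     {zs \<in> permutations_of_set {1..n}. set (take l (drop k2 zs)) = {k1 + 1..k1 + l}}"
  proof (rule bij_betw_Collect[OF bij_betw_Perms_permutations_of_set], unfold set_eq)
    fix \<pi> assume "\<pi> \<in> Perms n"
    then have "inj \<pi>" by (auto simp: Perms_def permutes_inj)
    then show "\<pi> ` {k2 + 1..k2 + l} = {k1 + 1..k1 + l} \<longleftrightarrow> has_arrangement l (Perms l) k1 k2 \<pi>"
      by (simp add: has_arrangement_Perms_iff)
  qed
  then have "window_weight q n l k1 k2 =
      (\<Sum>\<pi> | \<pi> \<in> Perms n \<and> has_arrangement l (Perms l) k1 k2 \<pi>. q ^ inversions (?f \<pi>))"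
    unfolding window_weight_def by (rule sum.reindex_bij_betw[symmetric])
  also have "\<dots> = (\<Sum>\<pi> | \<pi> \<in> Perms n \<and> has_arrangement l (Perms l) k1 k2 \<pi>. q ^ inv_count n \<pi>)"
  proof (intro sum.cong refl, goal_cases)
    case (1 \<pi>)
    then have "inj_on \<pi> {1..n}" unfolding Perms_def by (blast intro: permutes_inj_on)
    then show ?case by (simp only: inv_count_eq_inversions)
  qed
  finally show ?thesis by (rule sym)
qed

lemma sum_inv_count_Perms:
  assumes "q \<noteq> 1"
  shows "(\<Sum>\<pi>\<in>Perms n. q ^ inv_count n \<pi>) = qfact q n"
proof -
  have "(\<Sum>\<pi>\<in>Perms n. q ^ inv_count n \<pi>) = (\<Sum>\<pi>\<in>Perms n. q ^ inversions (map \<pi> [1..<Suc n]))"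
    by (intro sum.cong refl) (simp add: Perms_def inv_count_eq_inversions permutes_inj_on del: upt_Suc)
  also have "\<dots> = (\<Sum>zs\<in>permutations_of_set {1..n}. q ^ inversions zs)"
    by (rule sum.reindex_bij_betw[OF bij_betw_Perms_permutations_of_set])
  finally show ?thesis using assms by (simp add: sum_inversions_permutations)
qed

lemma expectation_Arr:
  assumes "0 < q" "q < 1" "l \<le> n"
  shows "measure_pmf.expectation (mallows n q) (\<lambda>\<pi>. real (Arr n l (Perms l) \<pi>)) =
    (\<Sum>k2\<le>n - l. \<Sum>k1\<le>n - l. window_weight q n l k1 k2) / qfact q n"
proof -
  have Arr: "real (Arr n l (Perms l) \<pi>) =
      (\<Sum>k2\<le>n - l. \<Sum>k1\<le>n - l. of_bool (has_arrangement l (Perms l) k1 k2 \<pi>))" for \<pi>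
  proof -
    have "{(k1, k2). k1 + l \<le> n \<and> k2 + l \<le> n \<and> has_arrangement l (Perms l) k1 k2 \<pi>} =
      {x \<in> {..n - l} \<times> {..n - l}. has_arrangement l (Perms l) (fst x) (snd x) \<pi>}"
      using assms(3) by auto
    then have "real (Arr n l (Perms l) \<pi>) = (\<Sum>x \<in> {..n - l} \<times> {..n - l}.
       of_bool (has_arrangement l (Perms l) (fst x) (snd x) \<pi>))"
      unfolding Arr_def by (simp add: Int_def)
    also have "\<dots> = (\<Sum>k2\<le>n - l. \<Sum>k1\<le>n - l. of_bool (has_arrangement l (Perms l) k1 k2 \<pi>))"
      by (subst sum.swap) (simp only: sum.cartesian_product case_prod_unfold)
    finally show ?thesis .
  qed
  have "measure_pmf.expectation (mallows n q) (\<lambda>\<pi>. real (Arr n l (Perms l) \<pi>)) =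
      (\<Sum>\<pi>\<in>Perms n. real (Arr n l (Perms l) \<pi>) * pmf (mallows n q) \<pi>)"
    using assms
    by (intro integral_measure_pmf_real finite_Perms)
       (auto simp: set_pmf_iff pmf_mallows mallows_weight_def split: if_splits)
  also have "\<dots> = (\<Sum>\<pi>\<in>Perms n. real (Arr n l (Perms l) \<pi>) * q ^ inv_count n \<pi>) / qfact q n"
    using assms by (simp add: pmf_mallows mallows_weight_def sum_inv_count_Perms sum_divide_distrib)
  also have "(\<Sum>\<pi>\<in>Perms n. real (Arr n l (Perms l) \<pi>) * q ^ inv_count n \<pi>) =
      (\<Sum>k2\<le>n - l. \<Sum>k1\<le>n - l. \<Sum>\<pi>\<in>Perms n.
        of_bool (has_arrangement l (Perms l) k1 k2 \<pi>) * q ^ inv_count n \<pi>)"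
    unfolding Arr sum_distrib_right
    by (subst sum.swap, intro sum.cong refl, subst sum.swap) (rule refl)
  also have "\<dots> = (\<Sum>k2\<le>n - l. \<Sum>k1\<le>n - l. window_weight q n l k1 k2)"
    using assms(3)
    by (intro sum.cong refl, subst sum_Perms_eq_window_weight[symmetric])
       (auto simp: finite_Perms intro!: sum.mono_neutral_cong_right)
  finally show ?thesis .
qed

section \<open>The exact expected number of arrangements\<close>

lemma sum_subsets_Un_disjoint:
  fixes g :: "'a set \<Rightarrow> real"
  assumes "finite L" "finite U" "L \<inter> U = {}"
  shows "(\<Sum>B | B \<subseteq> L \<union> U \<and> card B = k. g B) =
    (\<Sum>r\<le>card L. \<Sum>a\<le>card U. of_bool (r + a = k) *
       (\<Sum>X | X \<subseteq> L \<and> card X = r. \<Sum>Y | Y \<subseteq> U \<and> card Y = a. g (X \<union> Y)))"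
proof -
  have gr: "(\<Sum>r\<le>card S. \<Sum>X | X \<subseteq> S \<and> card X = r. f r X) = (\<Sum>X\<in>Pow S. f (card X) X)"
    if "finite S" for S :: "'a set" and f :: "nat \<Rightarrow> 'a set \<Rightarrow> real"
  proof -
    have "(\<Sum>r\<le>card S. \<Sum>X | X \<subseteq> S \<and> card X = r. f r X) =
        (\<Sum>r\<le>card S. \<Sum>X | X \<in> Pow S \<and> card X = r. f (card X) X)"
      by (intro sum.cong) auto
    also have "\<dots> = (\<Sum>X\<in>Pow S. f (card X) X)"
      using that by (intro sum.group) (auto intro: card_mono)
    finally show ?thesis .
  qed
  have "(\<Sum>r\<le>card L. \<Sum>a\<le>card U. of_bool (r + a = k) *
       (\<Sum>X | X \<subseteq> L \<and> card X = r. \<Sum>Y | Y \<subseteq> U \<and> card Y = a. g (X \<union> Y))) =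
     (\<Sum>r\<le>card L. \<Sum>X | X \<subseteq> L \<and> card X = r.
       \<Sum>a\<le>card U. \<Sum>Y | Y \<subseteq> U \<and> card Y = a. of_bool (r + a = k) * g (X \<union> Y))"
    unfolding sum_distrib_left by (intro sum.cong refl, rule sum.swap)
  also have "\<dots> = (\<Sum>X\<in>Pow L. \<Sum>Y\<in>Pow U. of_bool (card X + card Y = k) * g (X \<union> Y))"
    unfolding gr[OF assms(2)] gr[OF assms(1)] ..
  also have "\<dots> = (\<Sum>XY\<in>Pow L \<times> Pow U. of_bool (card (fst XY) + card (snd XY) = k) * g (fst XY \<union> snd XY))"
    by (simp only: sum.cartesian_product case_prod_unfold)
  also have "\<dots> = (\<Sum>B\<in>Pow (L \<union> U). of_bool (card B = k) * g B)"
  proof (rule sum.reindex_bij_witness[where i = "\<lambda>B. (B \<inter> L, B \<inter> U)" and j = "\<lambda>XY. fst XY \<union> snd XY"],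
      goal_cases)
    case (5 XY)
    then have sub: "fst XY \<subseteq> L" "snd XY \<subseteq> U" by auto
    then have "card (fst XY \<union> snd XY) = card (fst XY) + card (snd XY)"
      using assms by (intro card_Un_disjoint) (auto intro: finite_subset)
    then show ?case by simp
  qed (use assms in auto)
  also have "\<dots> = (\<Sum>B | B \<subseteq> L \<union> U \<and> card B = k. g B)"
    using assms by (intro sum.mono_neutral_cong_right) auto
  finally show ?thesis by (rule sym)
qed

text \<open>
  This is the source of the exponent \<open>a b + l (a + b)\<close>. A block \<open>J\<close> of values lies between the lower values
  \<open>L\<close> and the upper values \<open>U\<close>; the values \<open>X \<union> Y\<close> are placed to the left of \<open>J\<close> and the others to its
  right. The forced inversions are those between \<open>Y\<close> and \<open>L - X\<close>, between \<open>Y\<close> and \<open>J\<close>, and between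
  \<open>J\<close> and \<open>L - X\<close>.
\<close>

lemma cross_inv_around_block:
  assumes "finite L" "finite J" "finite U" "X \<subseteq> L" "Y \<subseteq> U"
    and LJ: "\<And>x y. x \<in> L \<Longrightarrow> y \<in> J \<Longrightarrow> x < y" and JU: "\<And>x y. x \<in> J \<Longrightarrow> y \<in> U \<Longrightarrow> x < y"
    and LU: "\<And>x y. x \<in> L \<Longrightarrow> y \<in> U \<Longrightarrow> x < y"
  shows "cross_inv (X \<union> Y) ((L \<union> J \<union> U) - (X \<union> Y)) + cross_inv J ((L \<union> J \<union> U) - (X \<union> Y) - J) =
    cross_inv X (L - X) + cross_inv Y (U - Y) + card (L - X) * card Y
      + card J * (card (L - X) + card Y)"
proof -
  note fin = finite_subset[OF assms(4,1)] finite_subset[OF assms(5,3)] assms(1-3)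
  have disj: "L \<inter> J = {}" "J \<inter> U = {}" "L \<inter> U = {}"
    using LJ JU LU by (meson disjoint_iff less_irrefl)+
  have e1: "(L \<union> J \<union> U) - (X \<union> Y) = (L - X) \<union> (J \<union> (U - Y))"
    using disj assms(4,5) by blast
  have e2: "(L - X) \<union> (J \<union> (U - Y)) - J = (L - X) \<union> (U - Y)"
    using disj assms(4,5) by blast
  have 1: "cross_inv (X \<union> Y) Z = cross_inv X Z + cross_inv Y Z" if "finite Z" for Z
    using fin disj assms(4,5) that by (intro cross_inv_Un_left) auto
  have 2: "cross_inv Z ((L - X) \<union> (J \<union> (U - Y))) =
      cross_inv Z (L - X) + (cross_inv Z J + cross_inv Z (U - Y))" if "finite Z" for Z
  proof -
    have "cross_inv Z ((L - X) \<union> (J \<union> (U - Y))) =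
        cross_inv Z (L - X) + cross_inv Z (J \<union> (U - Y))"
      using fin disj that by (intro cross_inv_Un_right) auto
    also have "cross_inv Z (J \<union> (U - Y)) = cross_inv Z J + cross_inv Z (U - Y)"
      using fin disj that by (intro cross_inv_Un_right) auto
    finally show ?thesis .
  qed
  have 3: "cross_inv J ((L - X) \<union> (U - Y)) = cross_inv J (L - X) + cross_inv J (U - Y)"
    using fin disj by (intro cross_inv_Un_right) auto
  have "cross_inv X J = 0" "cross_inv X (U - Y) = 0" "cross_inv J (U - Y) = 0"
    using LJ LU JU assms(4,5) by (auto intro!: cross_inv_less)
  moreover have "cross_inv Y (L - X) = card Y * card (L - X)" "cross_inv Y J = card Y * card J"
      "cross_inv J (L - X) = card J * card (L - X)"
    using LJ LU JU assms(4,5) by (auto intro!: cross_inv_greater)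
  ultimately show ?thesis
    unfolding e1 e2 using fin by (simp add: 1 2 3 algebra_simps)
qed

definition qbinom :: "real \<Rightarrow> nat \<Rightarrow> nat \<Rightarrow> real" where
  "qbinom q n k = qfact q n / (qfact q k * qfact q (n - k))"

text \<open>
  The list is cut before and after the window. Here \<open>r\<close> counts the values below the interval placed to
  the left of the window, and \<open>a\<close> the values above it placed there, so that \<open>b = k1 - r\<close> values below are
  placed to the right.
\<close>

lemma window_weight_eq:
  assumes "0 < q" "q < 1" "k1 + l \<le> n" "k2 + l \<le> n"
  shows "window_weight q n l k1 k2 = qfact q k2 * qfact q l * qfact q (n - l - k2) *
    (\<Sum>r\<le>k1. \<Sum>a\<le>n - l - k1. of_bool (r + a = k2) *
       (qbinom q k1 r * qbinom q (n - l - k1) a * q ^ ((k1 - r) * a + l * ((k1 - r) + a))))"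
proof -
  define L where "L = {1..k1}"
  define J where "J = {k1 + 1..k1 + l}"
  define U where "U = {k1 + l + 1..n}"
  define A where "A = {1..n}"
  have A: "A = L \<union> J \<union> U" unfolding A_def L_def J_def U_def using assms by auto
  have fin: "finite L" "finite J" "finite U" "finite A"
    by (auto simp: L_def J_def U_def A_def)
  have card: "card L = k1" "card J = l" "card U = n - l - k1" "card A = n"
    by (auto simp: L_def J_def U_def A_def)
  have disj: "L \<inter> J = {}" "J \<inter> U = {}" "L \<inter> U = {}"
    by (auto simp: L_def J_def U_def)
  have q1: "q \<noteq> 1" using assms by simp
  let ?c = "qfact q k2 * qfact q l * qfact q (n - l - k2)"
  have "window_weight q n l k1 k2 =
      (\<Sum>zs \<in> {zs \<in> permutations_of_set A. set (take l (drop k2 zs)) = J}. q ^ inversions zs)"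
    by (simp add: window_weight_def A_def J_def)
  also have "\<dots> = (\<Sum>B | B \<subseteq> A \<and> card B = k2.
           q ^ cross_inv B (A - B) * (\<Sum>xs \<in> permutations_of_set B. q ^ inversions xs) *
           (\<Sum>ys \<in> {ys \<in> permutations_of_set (A - B). set (take l ys) = J}. q ^ inversions ys))"
    using sum_permutations_by_prefix[of A k2 q "\<lambda>ys. set (take l ys) = J"] fin card assms by simp
  also have "\<dots> = (\<Sum>B | B \<subseteq> L \<union> U \<and> card B = k2.
           q ^ (cross_inv B (A - B) + cross_inv J (A - B - J)) * ?c)"
  proof (intro sum.mono_neutral_cong_right, goal_cases)
    case 1
    then show ?case using fin by simp
  next
    case 2
    then show ?case using A by auto
  next
    case 3
    show ?case
    proof
      \<comment> \<open>If a value of the interval is already used before the window, no completion exists.\<close>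
      fix B assume B: "B \<in> {B. B \<subseteq> A \<and> card B = k2} - {B. B \<subseteq> L \<union> U \<and> card B = k2}"
      then obtain x where x: "x \<in> B" "x \<in> J" using A by auto
      have "{ys \<in> permutations_of_set (A - B). set (take l ys) = J} = {}"
      proof (rule equals0I)
        fix ys assume ys: "ys \<in> {ys \<in> permutations_of_set (A - B). set (take l ys) = J}"
        then have "J \<subseteq> set ys" using set_take_subset by fastforce
        then show False using ys x by (auto simp: permutations_of_set_def)
      qed
      then show "q ^ cross_inv B (A - B) * (\<Sum>xs \<in> permutations_of_set B. q ^ inversions xs) *
           (\<Sum>ys \<in> {ys \<in> permutations_of_set (A - B). set (take l ys) = J}. q ^ inversions ys) = 0"
        by (simp only: sum.empty mult_zero_right)
    qed
  next
    case (4 B)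
    then have B: "B \<subseteq> L \<union> U" "card B = k2" by auto
    then have finB: "finite B" using fin finite_subset by blast
    have JAB: "J \<subseteq> A - B" using A B disj by auto
    have c: "card (A - B - J) = n - l - k2"
    proof -
      have "card (A - B - J) = card (A - B) - card J"
        using fin JAB by (intro card_Diff_subset)
      also have "card (A - B) = card A - card B"
        using finB B A by (intro card_Diff_subset) auto
      finally show ?thesis using B card by simp
    qed
    \<comment> \<open>The second cut, directly after the window.\<close>
    have "(\<Sum>ys \<in> {ys \<in> permutations_of_set (A - B). set (take l ys) = J}. q ^ inversions ys) =
       q ^ cross_inv J (A - B - J) * qfact q l * qfact q (n - l - k2)"
      using sum_permutations_prefix[of "A - B" J q "\<lambda>_. True"] JAB fin card c q1
      by (simp add: sum_inversions_permutations)
    moreover have "(\<Sum>xs \<in> permutations_of_set B. q ^ inversions xs) = qfact q k2"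
      using sum_inversions_permutations[OF finB q1] B by simp
    ultimately show ?case by (simp add: power_add)
  qed
  also have "\<dots> = (\<Sum>r\<le>k1. \<Sum>a\<le>n - l - k1. of_bool (r + a = k2) *
       (\<Sum>X | X \<subseteq> L \<and> card X = r. \<Sum>Y | Y \<subseteq> U \<and> card Y = a.
         q ^ (cross_inv (X \<union> Y) (A - (X \<union> Y)) + cross_inv J (A - (X \<union> Y) - J)) * ?c))"
    using sum_subsets_Un_disjoint[OF fin(1,3) disj(3), where k = k2] unfolding card by simp
  also have "\<dots> = (\<Sum>r\<le>k1. \<Sum>a\<le>n - l - k1. of_bool (r + a = k2) *
       (qbinom q k1 r * qbinom q (n - l - k1) a * q ^ ((k1 - r) * a + l * ((k1 - r) + a)) * ?c))"
  proof (intro sum.cong refl arg_cong2[where f = "(*)"])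
    fix r a assume ra: "r \<in> {..k1}" "a \<in> {..n - l - k1}"
    let ?e = "(k1 - r) * a + l * ((k1 - r) + a)"
    have "(\<Sum>X | X \<subseteq> L \<and> card X = r. \<Sum>Y | Y \<subseteq> U \<and> card Y = a.
         q ^ (cross_inv (X \<union> Y) (A - (X \<union> Y)) + cross_inv J (A - (X \<union> Y) - J)) * ?c) =
       (\<Sum>X | X \<subseteq> L \<and> card X = r. \<Sum>Y | Y \<subseteq> U \<and> card Y = a.
         (q ^ cross_inv X (L - X) * q ^ cross_inv Y (U - Y)) * (q ^ ?e * ?c))"
    proof (intro sum.cong refl)
      fix X Y assume "X \<in> {X. X \<subseteq> L \<and> card X = r}" "Y \<in> {Y. Y \<subseteq> U \<and> card Y = a}"
      then have XY: "X \<subseteq> L" "card X = r" "Y \<subseteq> U" "card Y = a" by auto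
      have "card (L - X) = k1 - r"
        using XY fin card by (simp add: card_Diff_subset finite_subset)
      moreover have "cross_inv (X \<union> Y) (A - (X \<union> Y)) + cross_inv J (A - (X \<union> Y) - J) =
          cross_inv X (L - X) + cross_inv Y (U - Y) + card (L - X) * card Y
            + card J * (card (L - X) + card Y)"
        unfolding A by (rule cross_inv_around_block[OF fin(1-3) XY(1,3)])
          (auto simp: L_def J_def U_def)
      ultimately have "cross_inv (X \<union> Y) (A - (X \<union> Y)) + cross_inv J (A - (X \<union> Y) - J) =
          cross_inv X (L - X) + cross_inv Y (U - Y) + ?e"
        using XY card by simp
      then show "q ^ (cross_inv (X \<union> Y) (A - (X \<union> Y)) + cross_inv J (A - (X \<union> Y) - J)) * ?c =
          (q ^ cross_inv X (L - X) * q ^ cross_inv Y (U - Y)) * (q ^ ?e * ?c)"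
        by (simp only: power_add mult.assoc)
    qed
    also have "\<dots> = (\<Sum>X | X \<subseteq> L \<and> card X = r. q ^ cross_inv X (L - X)) *
        (\<Sum>Y | Y \<subseteq> U \<and> card Y = a. q ^ cross_inv Y (U - Y)) * (q ^ ?e * ?c)"
      by (simp only: sum_product) (simp only: sum_distrib_right)
    also have "(\<Sum>X | X \<subseteq> L \<and> card X = r. q ^ cross_inv X (L - X)) = qbinom q k1 r"
      using sum_cross_inv_subsets[of L q r] fin card ra assms by (simp add: qbinom_def)
    also have "(\<Sum>Y | Y \<subseteq> U \<and> card Y = a. q ^ cross_inv Y (U - Y)) = qbinom q (n - l - k1) a"
      using sum_cross_inv_subsets[of U q a] fin card ra assms by (simp add: qbinom_def)
    finally show "(\<Sum>X | X \<subseteq> L \<and> card X = r. \<Sum>Y | Y \<subseteq> U \<and> card Y = a.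
         q ^ (cross_inv (X \<union> Y) (A - (X \<union> Y)) + cross_inv J (A - (X \<union> Y) - J)) * ?c) =
       qbinom q k1 r * qbinom q (n - l - k1) a * q ^ ?e * ?c"
      by (simp only: mult.assoc)
  qed
  also have "\<dots> = ?c * (\<Sum>r\<le>k1. \<Sum>a\<le>n - l - k1. of_bool (r + a = k2) *
       (qbinom q k1 r * qbinom q (n - l - k1) a * q ^ ((k1 - r) * a + l * ((k1 - r) + a))))"
    unfolding sum_distrib_left by (intro sum.cong refl) (simp only: mult_ac)
  finally show ?thesis .
qed

text \<open>
  The summand of the exact formula with \<open>k\<close> positions to the left of the window and \<open>j\<close> to its right.
  In terms of \<open>qpoch\<close> all powers of \<open>1 - q\<close> cancel. The form is symmetric under exchanging \<open>(k, a)\<close> with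
  \<open>(j, b)\<close>, which is the reversal of both positions and values.
\<close>

definition position_term :: "real \<Rightarrow> nat \<Rightarrow> nat \<Rightarrow> nat \<Rightarrow> nat \<Rightarrow> nat \<Rightarrow> real" where
  "position_term q l k j a b =
     qpoch q k * qpoch q j / qpoch q (k + j + l) *
     (qpoch q (k - a + b) * qpoch q (j - b + a) /
       (qpoch q (k - a) * qpoch q b * qpoch q a * qpoch q (j - b))) *
     q ^ (a * b + l * (a + b))"

text \<open>
  For a fixed window of positions, summing over the interval of values turns the triple sum over
  \<open>(k1, r, a)\<close> with \<open>r + a = k\<close> into a free sum over \<open>a \<le> k\<close> and \<open>b \<le> j\<close>, by \<open>k1 = k - a + b\<close>.
\<close>

lemma sum_window_weight:
  assumes "0 < q" "q < 1" "k + l \<le> n"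
  shows "(\<Sum>k1\<le>n - l. window_weight q n l k1 k) / qfact q n =
    qpoch q l * (\<Sum>a\<le>k. \<Sum>b\<le>n - l - k. position_term q l k (n - l - k) a b)"
proof -
  define m where "m = n - l"
  let ?S = "{(k1, r, a). k1 \<le> m \<and> r \<le> k1 \<and> a \<le> m - k1 \<and> r + a = k}"
  let ?c = "qfact q k * qfact q l * qfact q (m - k)"
  let ?t = "\<lambda>k1 r a. qbinom q k1 r * qbinom q (m - k1) a * q ^ ((k1 - r) * a + l * ((k1 - r) + a))"
  have "(\<Sum>k1\<le>n - l. window_weight q n l k1 k) =
      (\<Sum>k1\<le>m. ?c * (\<Sum>r\<le>k1. \<Sum>a\<le>m - k1. of_bool (r + a = k) * ?t k1 r a))"
    unfolding m_def using assms by (intro sum.cong refl window_weight_eq) auto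
  also have "\<dots> = ?c * (\<Sum>k1\<le>m. \<Sum>r\<le>k1. \<Sum>a\<le>m - k1. of_bool (r + a = k) * ?t k1 r a)"
    by (simp only: sum_distrib_left)
  also have "(\<Sum>k1\<le>m. \<Sum>r\<le>k1. \<Sum>a\<le>m - k1. of_bool (r + a = k) * ?t k1 r a) =
      (\<Sum>(k1, r, a) \<in> (SIGMA k1 : {..m}. {..k1} \<times> {..m - k1}). of_bool (r + a = k) * ?t k1 r a)"
    by (simp only: sum.cartesian_product, subst sum.Sigma) auto
  also have "\<dots> = (\<Sum>(k1, r, a) \<in> ?S. ?t k1 r a)"
    by (intro sum.mono_neutral_cong_right) auto
  also have "\<dots> = (\<Sum>(a, b) \<in> {..k} \<times> {..m - k}. ?t (k - a + b) (k - a) a)"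
    by (rule sum.reindex_bij_witness[where i = "\<lambda>(a, b). (k - a + b, k - a, a)"
          and j = "\<lambda>(k1, r, a). (a, k1 - r)"]) (use assms m_def in auto)
  finally have "(\<Sum>k1\<le>n - l. window_weight q n l k1 k) / qfact q n =
      (\<Sum>(a, b) \<in> {..k} \<times> {..m - k}. ?c * ?t (k - a + b) (k - a) a / qfact q n)"
    by (simp only: sum_distrib_left sum_divide_distrib case_prod_unfold)
  also have "\<dots> = (\<Sum>(a, b) \<in> {..k} \<times> {..m - k}. qpoch q l * position_term q l k (m - k) a b)"
  proof (intro sum.cong refl, clarify, goal_cases)
    case (1 a b)
    then have ab: "a \<le> k" "b \<le> m - k" by auto
    have m: "k \<le> m" "n = m + l" using assms m_def by auto
    have e: "m - (k - a + b) = m - k - b + a" "k - a + b - (k - a) = b" "m - k - b + a - a = m - k - b"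
      "k + (m - k) + l = n"
      using ab m by auto
    define p where "p = 1 - q"
    have p: "p \<noteq> 0" using assms p_def by simp
    have pz: "qpoch q i \<noteq> 0" for i using qpoch_pos[OF assms(1,2), of i] by simp
    have pp: "p ^ k * p ^ l * p ^ (m - k) = p ^ n"
      using m by (simp flip: power_add add: add.commute)
    have "p ^ (k - a) * p ^ b = p ^ (k - a + b)" "p ^ a * p ^ (m - k - b) = p ^ (m - k - b + a)"
      by (simp_all flip: power_add add: add.commute)
    then have binom: "qbinom q (k - a + b) (k - a) = qpoch q (k - a + b) / (qpoch q (k - a) * qpoch q b)"
      "qbinom q (m - (k - a + b)) a = qpoch q (m - k - b + a) / (qpoch q a * qpoch q (m - k - b))"
      unfolding qbinom_def qfact_def e p_def[symmetric]
      using pz p by (simp_all add: field_simps)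
    have c: "?c / qfact q n = qpoch q l * (qpoch q k * qpoch q (m - k) / qpoch q n)"
      unfolding qfact_def p_def[symmetric] pp[symmetric] using pz p by (simp add: field_simps)
    have ex: "(k - a + b - (k - a)) * a + l * (k - a + b - (k - a) + a) = a * b + l * (a + b)"
      by (simp add: algebra_simps)
    have "?c * ?t (k - a + b) (k - a) a / qfact q n = ?c / qfact q n * ?t (k - a + b) (k - a) a"
      by (rule times_divide_eq_left[symmetric])
    also have "\<dots> = qpoch q l * position_term q l k (m - k) a b"
      unfolding binom c ex position_term_def e(4) by (simp add: mult_ac)
    finally show ?case .
  qed
  also have "\<dots> = qpoch q l * (\<Sum>a\<le>k. \<Sum>b\<le>m - k. position_term q l k (m - k) a b)"
    by (simp only: sum_distrib_left sum.cartesian_product case_prod_unfold)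
  finally show ?thesis unfolding m_def .
qed

lemma position_term_commute: "position_term q l k j a b = position_term q l j k b a"
  by (simp add: position_term_def add_ac mult_ac)

text \<open>
  The expected number of arrangements in which the window of positions is preceded by \<open>k\<close> and followed
  by \<open>j\<close> positions, in the form given by \<open>sum_window_weight\<close>.
\<close>

definition position_mean :: "real \<Rightarrow> nat \<Rightarrow> nat \<Rightarrow> nat \<Rightarrow> real" where
  "position_mean q l k j = qpoch q l * (\<Sum>a\<le>k. \<Sum>b\<le>j. position_term q l k j a b)"

lemma position_mean_commute: "position_mean q l k j = position_mean q l j k"
  unfolding position_mean_def by (subst sum.swap) (simp add: position_term_commute[of q l k j])

lemma expectation_Arr_eq_sum_position_mean:
  assumes "0 < q" "q < 1" "l \<le> n"
  shows "measure_pmf.expectation (mallows n q) (\<lambda>\<pi>. real (Arr n l (Perms l) \<pi>)) =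
    (\<Sum>k\<le>n - l. position_mean q l k (n - l - k))"
proof -
  have "(\<Sum>k\<le>n - l. (\<Sum>k1\<le>n - l. window_weight q n l k1 k) / qfact q n) =
      (\<Sum>k\<le>n - l. position_mean q l k (n - l - k))"
    unfolding position_mean_def using assms by (intro sum.cong refl sum_window_weight) auto
  then show ?thesis
    using assms by (simp add: expectation_Arr flip: sum_divide_distrib)
qed

section \<open>Estimates for a single window of positions\<close>

lemma one_minus_power_le:
  fixes x :: real
  assumes "0 \<le> x"
  shows "1 - x ^ n \<le> real n * (1 - x)"
  using Bernoulli_inequality[of "x - 1" n] assms by (simp add: algebra_simps)

context
  fixes q :: real
  assumes q: "0 < q" "q < 1"
begin

lemma qpoch_antimono: "i \<le> j \<Longrightarrow> qpoch q j \<le> qpoch q i"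
proof (induction j rule: dec_induct)
  case (step n)
  have "qpoch q (Suc n) \<le> qpoch q n"
    unfolding qpoch_Suc using qpoch_pos[OF q, of n] q
    by (intro mult_left_le) (simp_all add: power_le_one del: power_Suc)
  with step show ?case by simp
qed simp

lemma qpoch_le_fact: "qpoch q n \<le> fact n * (1 - q) ^ n"
proof (induction n)
  case (Suc n)
  have "qpoch q (Suc n) \<le> (fact n * (1 - q) ^ n) * (real (Suc n) * (1 - q))"
    unfolding qpoch_Suc using q
    by (intro mult_mono Suc one_minus_power_le) (simp_all add: power_le_one del: power_Suc)
  then show ?case by (simp add: mult_ac)
qed simp

text \<open>
  The factors \<open>1 - q^(j + 1), 1 - q^(j + 2), \<dots>\<close> differ from one by a total of at most
  \<open>q^j / (1 - q)\<close>, and a product is at least one minus the sum of these differences.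
\<close>

lemma qpoch_add_ge:
  assumes "q ^ j / (1 - q) \<le> \<delta>"
  shows "(1 - \<delta>) * qpoch q j \<le> qpoch q (j + s)"
proof -
  have "qpoch q j * (1 - (q ^ Suc j - q ^ Suc (j + s)) / (1 - q)) \<le> qpoch q (j + s)"
  proof (induction s)
    case (Suc s)
    define x where "x = (q ^ Suc j - q ^ Suc (j + s)) / (1 - q)"
    define y where "y = q ^ Suc (j + s)"
    have "0 \<le> x" "0 \<le> y"
      unfolding x_def y_def using q by (auto intro!: divide_nonneg_nonneg power_decreasing)
    have "x + y = (q ^ Suc j - q ^ Suc (j + Suc s)) / (1 - q)"
      unfolding x_def y_def using q by (simp add: field_simps)
    then have "qpoch q j * (1 - (q ^ Suc j - q ^ Suc (j + Suc s)) / (1 - q)) =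
        qpoch q j * (1 - (x + y))" by (simp only:)
    also have "\<dots> \<le> qpoch q j * ((1 - x) * (1 - y))"
      using qpoch_pos[OF q, of j] \<open>0 \<le> x\<close> \<open>0 \<le> y\<close>
      by (intro mult_left_mono) (auto simp: algebra_simps)
    also have "\<dots> = (qpoch q j * (1 - x)) * (1 - y)"
      by (simp only: mult.assoc)
    also have "\<dots> \<le> qpoch q (j + s) * (1 - y)"
      using Suc q unfolding x_def y_def
      by (intro mult_right_mono) (simp_all add: power_le_one del: power_Suc)
    also have "\<dots> = qpoch q (j + Suc s)"
      by (simp add: qpoch_Suc y_def)
    finally show ?case .
  qed simp
  moreover have "(q ^ Suc j - q ^ Suc (j + s)) / (1 - q) \<le> q ^ j / (1 - q)"
    using q by (intro divide_right_mono) (auto simp: mult_left_le_one_le intro: order_trans[OF _ mult_left_le_one_le[of "q^j" q]])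
  then have "qpoch q j * (1 - \<delta>) \<le> qpoch q j * (1 - (q ^ Suc j - q ^ Suc (j + s)) / (1 - q))"
    using assms qpoch_pos[OF q, of j] by (intro mult_left_mono) auto
  ultimately show ?thesis by (simp add: mult.commute)
qed

text \<open>
  The cross-multiplied form of the monotonicity in \<open>a\<close> of \<open>(q)\<^sub>a\<^sub>+\<^sub>s / (q)\<^sub>a\<close>, whose factors
  \<open>1 - q^(a + t)\<close> all increase with \<open>a\<close>.
\<close>

lemma qpoch_cross_mono:
  assumes "a \<le> k"
  shows "qpoch q (a + s) * qpoch q k \<le> qpoch q (k + s) * qpoch q a"
proof (induction s)
  case (Suc s)
  have "qpoch q (a + Suc s) * qpoch q k = (qpoch q (a + s) * qpoch q k) * (1 - q ^ Suc (a + s))"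
    by (simp add: qpoch_Suc)
  also have "\<dots> \<le> (qpoch q (k + s) * qpoch q a) * (1 - q ^ Suc (k + s))"
  proof (rule mult_mono[OF Suc])
    show "1 - q ^ Suc (a + s) \<le> 1 - q ^ Suc (k + s)"
      using assms q by (intro diff_left_mono power_decreasing) auto
    show "0 \<le> 1 - q ^ Suc (a + s)"
      using q by (simp add: power_le_one del: power_Suc)
  qed (use less_imp_le[OF qpoch_pos[OF q]] in simp)
  also have "\<dots> = qpoch q (k + Suc s) * qpoch q a"
    by (simp add: qpoch_Suc)
  finally show ?case .
qed (simp add: mult.commute)

text \<open>
  The \<open>q\<close>-binomial theorem with a negative exponent, multiplied by \<open>(q)\<^sub>r\<close>. In the induction on \<open>r\<close> the
  new factor \<open>1 - q^(r + 1 + b)\<close> splits the series into the series for \<open>r\<close> at \<open>x\<close> and at \<open>x q\<close>.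
\<close>

lemma sums_qpoch_ratio:
  assumes "0 \<le> x" "x < 1"
  shows "(\<lambda>b. x ^ b * (qpoch q (r + b) / qpoch q b)) sums (qpoch q r / (\<Prod>i\<le>r. 1 - x * q ^ i))"
  using assms
proof (induction r arbitrary: x)
  case 0
  have "qpoch q b / qpoch q b = 1" for b using qpoch_pos[OF q, of b] by simp
  then show ?case using geometric_sums[of x] 0 by simp
next
  case (Suc r)
  define A where "A = (\<Prod>i\<le>r. 1 - x * q ^ i)"
  define B where "B = (\<Prod>i\<le>r. 1 - (x * q) * q ^ i)"
  have lt: "x * q ^ i < 1" for i
  proof -
    have "x * q ^ i \<le> x * 1" using q Suc.prems by (intro mult_left_mono) (auto intro: power_le_one)
    then show ?thesis using Suc.prems by simp
  qed
  have pos: "A > 0" "B > 0" "1 - x > 0" "1 - x * q ^ Suc r > 0"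
    unfolding A_def B_def using lt[of "Suc _"] lt[of "Suc r"] lt Suc.prems
    by (auto intro!: prod_pos simp: mult.assoc)
  have T1: "(\<Prod>i\<le>Suc r. 1 - x * q ^ i) = A * (1 - x * q ^ Suc r)"
    by (simp add: A_def)
  have T2: "(\<Prod>i\<le>Suc r. 1 - x * q ^ i) = (1 - x) * B"
    unfolding B_def by (subst prod.atMost_Suc_shift) (simp add: mult_ac)
  have AB: "A * (1 - x * q ^ Suc r) = (1 - x) * B" by (rule trans[OF T1[symmetric] T2])
  have xq: "0 \<le> x * q" "x * q < 1" using lt[of 1] q Suc.prems by auto
  have "(\<lambda>b. x ^ b * (qpoch q (r + b) / qpoch q b) -
        q ^ Suc r * ((x * q) ^ b * (qpoch q (r + b) / qpoch q b))) sums
      (qpoch q r / A - q ^ Suc r * (qpoch q r / B))"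
    unfolding A_def B_def
    by (intro sums_diff sums_mult Suc.IH Suc.prems xq)
  also have "(\<lambda>b. x ^ b * (qpoch q (r + b) / qpoch q b) -
        q ^ Suc r * ((x * q) ^ b * (qpoch q (r + b) / qpoch q b))) =
      (\<lambda>b. x ^ b * (qpoch q (Suc r + b) / qpoch q b))"
  proof
    fix b
    show "x ^ b * (qpoch q (r + b) / qpoch q b) -
        q ^ Suc r * ((x * q) ^ b * (qpoch q (r + b) / qpoch q b)) =
        x ^ b * (qpoch q (Suc r + b) / qpoch q b)"
      by (simp add: qpoch_Suc power_add power_mult_distrib diff_divide_distrib algebra_simps)
  qed
  also have "qpoch q r / A - q ^ Suc r * (qpoch q r / B) =
      qpoch q (Suc r) / (\<Prod>i\<le>Suc r. 1 - x * q ^ i)"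
  proof -
    have "qpoch q r / A = qpoch q r * (1 - x * q ^ Suc r) / (A * (1 - x * q ^ Suc r))"
      using pos by simp
    moreover have "qpoch q r / B = qpoch q r * (1 - x) / (A * (1 - x * q ^ Suc r))"
      unfolding AB using pos by simp
    ultimately show ?thesis
      unfolding T1 qpoch_Suc by (simp add: algebra_simps flip: diff_divide_distrib)
  qed
  finally show ?case .
qed

lemma prod_shifted_qpoch:
  "(\<Prod>i\<le>r. 1 - q ^ Suc c * q ^ i) = qpoch q (c + Suc r) / qpoch q c"
proof (induction r)
  case 0
  show ?case using qpoch_pos[OF q, of c] by (simp add: qpoch_Suc)
next
  case (Suc r)
  then show ?case by (simp add: qpoch_Suc power_add mult_ac)
qed

text \<open>
  The sum over \<open>b\<close>: the power of \<open>q\<close> linear in \<open>b\<close> makes this the \<open>q\<close>-binomial series at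
  \<open>x = q^(a + s + 1)\<close>. It is used for \<open>s + 1 = l\<close>, and for \<open>s + 1 = l - 1\<close> to bound the tail.
\<close>

lemma sums_position_term_inner:
  assumes "a \<le> k"
  shows "(\<lambda>b. q ^ ((a + Suc s) * b) * (qpoch q (k - a + b) / qpoch q b)) sums
    (qpoch q (k - a) * (qpoch q (a + s) / qpoch q (k + Suc s)))"
proof -
  have "(\<lambda>b. (q ^ Suc (a + s)) ^ b * (qpoch q (k - a + b) / qpoch q b)) sums
      (qpoch q (k - a) / (\<Prod>i\<le>k - a. 1 - q ^ Suc (a + s) * q ^ i))"
    using q by (intro sums_qpoch_ratio) (auto simp: power_less_one_iff simp del: power_Suc)
  moreover have "a + s + Suc (k - a) = k + Suc s" using assms by simp
  ultimately show ?thesis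
    by (simp only: prod_shifted_qpoch power_mult add_Suc_right divide_divide_eq_right times_divide_eq_right)
qed

text \<open>
  The sum over \<open>a\<close> of what remains after summation over \<open>b\<close> is again a \<open>q\<close>-binomial series, now at
  \<open>x = q^l\<close>. Its value is the bulk value of the expectation, up to the factor \<open>(q)\<^sub>l\<close>.
\<close>

lemma sums_position_term_outer:
  assumes "l \<ge> 1"
  shows "(\<lambda>a. q ^ (l * a) * (qpoch q (a + (l - 1)) / qpoch q a)) sums
    ((qpoch q (l - 1))\<^sup>2 / qpoch q (2 * l - 1))"
proof -
  have "(\<lambda>a. (q ^ Suc (l - 1)) ^ a * (qpoch q (l - 1 + a) / qpoch q a)) sums
      (qpoch q (l - 1) / (\<Prod>i\<le>l - 1. 1 - q ^ Suc (l - 1) * q ^ i))"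
    using q by (intro sums_qpoch_ratio) (auto simp: power_less_one_iff simp del: power_Suc)
  moreover have "l - 1 + Suc (l - 1) = 2 * l - 1" "Suc (l - 1) = l" using assms by simp_all
  ultimately show ?thesis
    unfolding prod_shifted_qpoch by (simp add: power_mult power2_eq_square add.commute)
qed

definition position_head :: "nat \<Rightarrow> nat \<Rightarrow> nat \<Rightarrow> real" where
  "position_head l k a = qpoch q k / (qpoch q a * qpoch q (k - a)) * q ^ (l * a)"

lemma position_head_nonneg: "0 \<le> position_head l k a"
  unfolding position_head_def using q less_imp_le[OF qpoch_pos[OF q]] by simp

lemma position_head_mult:
  "position_head l k a * (qpoch q (k - a) * (x / y)) = qpoch q k / y * (q ^ (l * a) * (x / qpoch q a))"
  unfolding position_head_def using qpoch_pos[OF q, of "k - a"] by simp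

text \<open>
  The summand as the product of a correction factor, which is close to one when \<open>j\<close> and \<open>j - b\<close> are
  large, and of the term for a permutation that extends infinitely to the right of the window.
\<close>

lemma position_term_eq:
  "position_term q l k j a b = qpoch q j / qpoch q (k + j + l) * (qpoch q (j - b + a) / qpoch q (j - b)) *
     (position_head l k a * (q ^ ((a + l) * b) * (qpoch q (k - a + b) / qpoch q b)))"
  unfolding position_term_def position_head_def by (simp add: power_add algebra_simps)

lemma position_term_nonneg: "0 \<le> position_term q l k j a b"
  unfolding position_term_def using q less_imp_le[OF qpoch_pos[OF q]] by simp

text \<open>
  The factor \<open>(q)\<^sub>j\<^sub>-\<^sub>b\<^sub>+\<^sub>a / (q)\<^sub>j\<^sub>-\<^sub>b\<close> is at most one, and then the sum over \<open>b\<close> may be extended to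
  infinity.
\<close>

lemma sum_position_term_le:
  assumes "l \<ge> 1"
  shows "(\<Sum>a\<le>k. \<Sum>b\<le>j. position_term q l k j a b) \<le>
    qpoch q j / qpoch q (k + j + l) * (qpoch q k / qpoch q (k + l) *
      (\<Sum>a\<le>k. q ^ (l * a) * (qpoch q (a + (l - 1)) / qpoch q a)))"
proof -
  let ?R = "qpoch q j / qpoch q (k + j + l)"
  have P: "0 < qpoch q i" "0 \<le> qpoch q i" for i using qpoch_pos[OF q, of i] by auto
  have "(\<Sum>b\<le>j. position_term q l k j a b) \<le>
      ?R * (qpoch q k / qpoch q (k + l) * (q ^ (l * a) * (qpoch q (a + (l - 1)) / qpoch q a)))"
    if a: "a \<le> k" for a
  proof -
    let ?f = "\<lambda>b. q ^ ((a + l) * b) * (qpoch q (k - a + b) / qpoch q b)"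
    have sums: "?f sums (qpoch q (k - a) * (qpoch q (a + (l - 1)) / qpoch q (k + l)))"
      using sums_position_term_inner[OF a, of "l - 1"] assms by simp
    have "(\<Sum>b\<le>j. ?f b) \<le> qpoch q (k - a) * (qpoch q (a + (l - 1)) / qpoch q (k + l))"
      unfolding sums_unique[OF sums] using P q sums_summable[OF sums]
      by (intro sum_le_suminf) auto
    then have "position_head l k a * (\<Sum>b\<le>j. ?f b) \<le>
        qpoch q k / qpoch q (k + l) * (q ^ (l * a) * (qpoch q (a + (l - 1)) / qpoch q a))"
      unfolding position_head_mult[symmetric] by (intro mult_left_mono position_head_nonneg)
    then have "?R * (position_head l k a * (\<Sum>b\<le>j. ?f b)) \<le>
        ?R * (qpoch q k / qpoch q (k + l) * (q ^ (l * a) * (qpoch q (a + (l - 1)) / qpoch q a)))"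
      using P by (intro mult_left_mono) auto
    moreover have "(\<Sum>b\<le>j. position_term q l k j a b) \<le> ?R * (position_head l k a * (\<Sum>b\<le>j. ?f b))"
      unfolding sum_distrib_left
    proof (rule sum_mono)
      fix b
      have "qpoch q (j - b + a) / qpoch q (j - b) \<le> 1"
        using P qpoch_antimono[of "j - b" "j - b + a"] by simp
      then have "?R * (qpoch q (j - b + a) / qpoch q (j - b)) \<le> ?R"
        using P by (intro mult_left_le) auto
      then show "position_term q l k j a b \<le> ?R * (position_head l k a * ?f b)"
        unfolding position_term_eq using P q position_head_nonneg by (intro mult_right_mono) auto
    qed
    ultimately show ?thesis by (rule order_trans[rotated])
  qed
  then have "(\<Sum>a\<le>k. \<Sum>b\<le>j. position_term q l k j a b) \<le>
      (\<Sum>a\<le>k. ?R * (qpoch q k / qpoch q (k + l) * (q ^ (l * a) * (qpoch q (a + (l - 1)) / qpoch q a))))"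
    by (intro sum_mono) auto
  then show ?thesis by (simp only: sum_distrib_left)
qed

text \<open>
  A bound uniform in \<open>k\<close>, for windows close to an end. The ratios \<open>(q)\<^sub>a\<^sub>+\<^sub>l\<^sub>-\<^sub>1 / (q)\<^sub>a\<close> with
  \<open>a \<le> k\<close> are largest for \<open>a = k\<close>, which leaves a geometric sum, and Bernoulli's inequality lets its numerator absorb
  the last factor \<open>1 - q^(k + l)\<close> of the denominator.
\<close>

lemma half_infinite_mean_le:
  assumes "l \<ge> 1"
  shows "qpoch q l * (qpoch q k / qpoch q (k + l) *
      (\<Sum>a\<le>k. q ^ (l * a) * (qpoch q (a + (l - 1)) / qpoch q a))) \<le> fact l * (1 - q) ^ (l - 1)"
proof -
  have P: "0 < qpoch q i" "0 \<le> qpoch q i" for i using qpoch_pos[OF q, of i] by auto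
  have l: "Suc (l - 1) = l" using assms by simp
  have ql: "q ^ l < 1" "q ^ (k + l) < 1" using q assms by (simp_all add: power_less_one_iff)
  have "(\<Sum>a\<le>k. q ^ (l * a) * (qpoch q (a + (l - 1)) / qpoch q a)) \<le>
      (\<Sum>a\<le>k. q ^ (l * a) * (qpoch q (k + (l - 1)) / qpoch q k))"
  proof (intro sum_mono mult_left_mono)
    fix a assume "a \<in> {..k}"
    then show "qpoch q (a + (l - 1)) / qpoch q a \<le> qpoch q (k + (l - 1)) / qpoch q k"
      using qpoch_cross_mono[of a k "l - 1"] P by (simp add: field_simps)
  qed (use q in auto)
  also have "\<dots> = (\<Sum>a<Suc k. (q ^ l) ^ a) * (qpoch q (k + (l - 1)) / qpoch q k)"
    by (simp only: sum_distrib_right power_mult lessThan_Suc_atMost)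
  finally have S1: "(\<Sum>a\<le>k. q ^ (l * a) * (qpoch q (a + (l - 1)) / qpoch q a)) \<le>
      (\<Sum>a<Suc k. (q ^ l) ^ a) * (qpoch q (k + (l - 1)) / qpoch q k)" .
  have "(\<Sum>a<Suc k. (q ^ l) ^ a) = (1 - (q ^ Suc k) ^ l) / (1 - q ^ l)"
    using ql by (subst sum_gp_strict) (simp add: power_mult[symmetric] mult.commute del: power_Suc)
  also have "\<dots> \<le> real l * (1 - q ^ (k + l)) / (1 - q ^ l)"
  proof (intro divide_right_mono)
    have "1 - (q ^ Suc k) ^ l \<le> real l * (1 - q ^ Suc k)"
      using q by (intro one_minus_power_le) simp
    also have "\<dots> \<le> real l * (1 - q ^ (k + l))"
      using q assms by (intro mult_left_mono diff_left_mono power_decreasing) auto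
    finally show "1 - (q ^ Suc k) ^ l \<le> real l * (1 - q ^ (k + l))" .
  qed (use ql in simp)
  finally have "(\<Sum>a<Suc k. (q ^ l) ^ a) \<le> real l * (1 - q ^ (k + l)) / (1 - q ^ l)" .
  then have "(\<Sum>a<Suc k. (q ^ l) ^ a) * (qpoch q (k + (l - 1)) / qpoch q k) \<le>
      real l * (1 - q ^ (k + l)) / (1 - q ^ l) * (qpoch q (k + (l - 1)) / qpoch q k)"
    by (rule mult_right_mono) (use P in simp)
  with S1 have "(\<Sum>a\<le>k. q ^ (l * a) * (qpoch q (a + (l - 1)) / qpoch q a)) \<le>
      real l * (1 - q ^ (k + l)) / (1 - q ^ l) * (qpoch q (k + (l - 1)) / qpoch q k)"
    by (rule order_trans)
  then have "qpoch q l * (qpoch q k / qpoch q (k + l) *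
      (\<Sum>a\<le>k. q ^ (l * a) * (qpoch q (a + (l - 1)) / qpoch q a))) \<le>
    qpoch q l * (qpoch q k / qpoch q (k + l) *
      (real l * (1 - q ^ (k + l)) / (1 - q ^ l) * (qpoch q (k + (l - 1)) / qpoch q k)))"
    using P by (intro mult_left_mono) auto
  also have "\<dots> = real l * qpoch q (l - 1)"
  proof -
    have "qpoch q l = qpoch q (l - 1) * (1 - q ^ l)" using qpoch_Suc[of q "l - 1"] l by simp
    moreover have "qpoch q (k + l) = qpoch q (k + (l - 1)) * (1 - q ^ (k + l))"
      using qpoch_Suc[of q "k + (l - 1)"] assms by simp
    moreover have "1 - q ^ l \<noteq> 0" "1 - q ^ (k + l) \<noteq> 0" using ql by simp_all
    ultimately show ?thesis using P(1)[of "k + (l - 1)"] P(1)[of k] by simp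
  qed
  also have "\<dots> \<le> real l * (fact (l - 1) * (1 - q) ^ (l - 1))"
    by (intro mult_left_mono qpoch_le_fact) simp
  also have "\<dots> = fact l * (1 - q) ^ (l - 1)"
    using fact_Suc[of "l - 1", where ?'a = real] unfolding l by simp
  finally show ?thesis .
qed

text \<open>
  For \<open>b < K\<close> the correction factor is at least \<open>1 - \<delta>\<close>. The three losses of \<open>\<delta>\<close> come from discarding
  the terms with \<open>b \<ge> K\<close>, twice because of a ratio bounded by two, and from discarding the terms
  with \<open>a > k\<close>. Since \<open>l \<ge> 2\<close>, one factor \<open>q^b \<le> q^K\<close> can be split off from \<open>q^(l b)\<close>, and the remaining
  series over \<open>b\<close> still has a closed form.
\<close>

lemma sum_position_term_ge:
  assumes "l \<ge> 2" "K \<le> k" "2 * K \<le> j" and \<delta>: "q ^ K / (1 - q) \<le> \<delta>" "\<delta> \<le> 1 / 2"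
  shows "(1 - \<delta>) * ((qpoch q (l - 1))\<^sup>2 / qpoch q (2 * l - 1) - 3 * \<delta>) \<le>
    (\<Sum>a\<le>k. \<Sum>b\<le>j. position_term q l k j a b)"
proof -
  let ?h = "\<lambda>a. q ^ (l * a) * (qpoch q (a + (l - 1)) / qpoch q a)"
  have P: "0 < qpoch q i" "0 \<le> qpoch q i" for i using qpoch_pos[OF q, of i] by auto
  have tailK: "q ^ i / (1 - q) \<le> \<delta>" if "K \<le> i" for i
  proof -
    have "q ^ i / (1 - q) \<le> q ^ K / (1 - q)"
      using q that by (intro divide_right_mono power_decreasing) auto
    with \<delta> show ?thesis by simp
  qed
  have row: "(1 - \<delta>) * (?h a - 2 * (q ^ K * q ^ a)) \<le> (\<Sum>b\<le>j. position_term q l k j a b)"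
    if a: "a \<le> k" for a
  proof -
    let ?f = "\<lambda>b. q ^ ((a + l) * b) * (qpoch q (k - a + b) / qpoch q b)"
    let ?g = "\<lambda>b. q ^ ((a + (l - 1)) * b) * (qpoch q (k - a + b) / qpoch q b)"
    have f: "?f sums (qpoch q (k - a) * (qpoch q (a + (l - 1)) / qpoch q (k + l)))"
      using sums_position_term_inner[OF a, of "l - 1"] assms by simp
    have "Suc (l - 2) = l - 1" using assms by simp
    with sums_position_term_inner[OF a, of "l - 2"]
    have g: "?g sums (qpoch q (k - a) * (qpoch q (a + (l - 2)) / qpoch q (k + (l - 1))))"
      by simp
    \<comment> \<open>The tail with exponent \<open>a + l\<close> is at most \<open>q^K\<close> times the series with exponent \<open>a + l - 1\<close>, whose sum is known.\<close>
    have fg: "?f b \<le> q ^ K * ?g b" if "K \<le> b" for b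
    proof -
      have "(a + l) * b = b + (a + (l - 1)) * b" using assms by (cases l) auto
      then have "?f b = q ^ b * ?g b" by (simp add: power_add)
      also have "\<dots> \<le> q ^ K * ?g b"
        using q that P by (intro mult_right_mono power_decreasing mult_nonneg_nonneg divide_nonneg_nonneg) auto
      finally show ?thesis .
    qed
    have "qpoch q (k - a) * (qpoch q (a + (l - 1)) / qpoch q (k + l)) -
        q ^ K * (qpoch q (k - a) * (qpoch q (a + (l - 2)) / qpoch q (k + (l - 1)))) \<le> (\<Sum>b<K. ?f b)"
    proof (rule sums_le[OF _ sums_diff[OF f sums_mult[OF g]] sums_If_finite_set])
      fix b
      show "?f b - q ^ K * ?g b \<le> (if b \<in> {..<K} then ?f b else 0)"
        using fg[of b] P q by auto
    qed simp
    then have "position_head l k a * (qpoch q (k - a) * (qpoch q (a + (l - 1)) / qpoch q (k + l)) -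
        q ^ K * (qpoch q (k - a) * (qpoch q (a + (l - 2)) / qpoch q (k + (l - 1))))) \<le>
        position_head l k a * (\<Sum>b<K. ?f b)"
      by (intro mult_left_mono position_head_nonneg)
    moreover have "position_head l k a * (qpoch q (k - a) * (qpoch q (a + (l - 1)) / qpoch q (k + l)) -
        q ^ K * (qpoch q (k - a) * (qpoch q (a + (l - 2)) / qpoch q (k + (l - 1))))) =
      qpoch q k / qpoch q (k + l) * ?h a -
        q ^ K * ((qpoch q k / qpoch q (k + (l - 1))) * (q ^ (l * a) * (qpoch q (a + (l - 2)) / qpoch q a)))"
      by (simp only: right_diff_distrib position_head_mult mult.left_commute[of "position_head l k a" "q ^ K"])
    moreover have "?h a \<le> qpoch q k / qpoch q (k + l) * ?h a"
    proof -
      have "1 \<le> qpoch q k / qpoch q (k + l)"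
        using P qpoch_antimono[of k "k + l"] by simp
      from mult_right_mono[OF this, of "?h a"] show ?thesis using P q by simp
    qed
    moreover have "(qpoch q k / qpoch q (k + (l - 1))) * (q ^ (l * a) * (qpoch q (a + (l - 2)) / qpoch q a)) \<le>
        2 * (q ^ a * 1)"
    proof (intro mult_mono)
      have "1 / 2 * qpoch q k \<le> (1 - \<delta>) * qpoch q k"
        using \<delta> P by (intro mult_right_mono) auto
      also have "\<dots> \<le> qpoch q (k + (l - 1))"
        using tailK[OF assms(2)] by (rule qpoch_add_ge)
      finally show "qpoch q k / qpoch q (k + (l - 1)) \<le> 2"
        using P(1)[of "k + (l - 1)"] by (simp add: field_simps)
      show "q ^ (l * a) \<le> q ^ a" using q assms by (intro power_decreasing) auto
      show "qpoch q (a + (l - 2)) / qpoch q a \<le> 1"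
        using P qpoch_antimono[of a "a + (l - 2)"] by simp
    qed (use P q in auto)
    then have "q ^ K * ((qpoch q k / qpoch q (k + (l - 1))) * (q ^ (l * a) * (qpoch q (a + (l - 2)) / qpoch q a))) \<le>
        q ^ K * (2 * (q ^ a * 1))"
      using q by (intro mult_left_mono) auto
    ultimately have "?h a - 2 * (q ^ K * q ^ a) \<le> position_head l k a * (\<Sum>b<K. ?f b)"
      by (simp add: algebra_simps)
    then have "(1 - \<delta>) * (?h a - 2 * (q ^ K * q ^ a)) \<le> (1 - \<delta>) * (position_head l k a * (\<Sum>b<K. ?f b))"
      using \<delta> by (intro mult_left_mono) auto
    also have "\<dots> = (\<Sum>b<K. (1 - \<delta>) * (position_head l k a * ?f b))"
      by (simp only: sum_distrib_left)
    also have "\<dots> \<le> (\<Sum>b<K. position_term q l k j a b)"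
    proof (rule sum_mono)
      fix b assume b: "b \<in> {..<K}"
      have "K \<le> j - b" using b assms by simp
      then have "(1 - \<delta>) * qpoch q (j - b) \<le> qpoch q (j - b + a)"
        by (intro qpoch_add_ge tailK)
      then have "1 - \<delta> \<le> qpoch q (j - b + a) / qpoch q (j - b)"
        using P(1)[of "j - b"] by (simp add: field_simps)
      moreover have "1 \<le> qpoch q j / qpoch q (k + j + l)"
        using P qpoch_antimono[of j "k + j + l"] by simp
      ultimately have "1 * (1 - \<delta>) \<le> qpoch q j / qpoch q (k + j + l) * (qpoch q (j - b + a) / qpoch q (j - b))"
        using \<delta> P by (intro mult_mono) auto
      then show "(1 - \<delta>) * (position_head l k a * ?f b) \<le> position_term q l k j a b"
        unfolding position_term_eq using P q position_head_nonneg by (intro mult_right_mono) auto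
    qed
    also have "\<dots> \<le> (\<Sum>b\<le>j. position_term q l k j a b)"
      using assms by (intro sum_mono2 position_term_nonneg) auto
    finally show ?thesis .
  qed
  have "(qpoch q (l - 1))\<^sup>2 / qpoch q (2 * l - 1) - q ^ K * (1 / (1 - q)) \<le> (\<Sum>a\<le>k. ?h a)"
  proof (rule sums_le[OF _ sums_diff[OF sums_position_term_outer sums_mult[OF geometric_sums]] sums_If_finite_set])
    fix a
    show "?h a - q ^ K * q ^ a \<le> (if a \<in> {..k} then ?h a else 0)"
    proof (cases "a \<le> k")
      case False
      have "?h a \<le> q ^ (K + a) * 1"
      proof (intro mult_mono)
        have "2 * a \<le> l * a" using assms(1) by (rule mult_le_mono1)
        then have "K + a \<le> l * a" using False assms(2) by linarith
        then show "q ^ (l * a) \<le> q ^ (K + a)"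
          using q by (intro power_decreasing) auto
        show "qpoch q (a + (l - 1)) / qpoch q a \<le> 1"
          using P qpoch_antimono[of a "a + (l - 1)"] by simp
      qed (use P q in auto)
      with False show ?thesis by (simp add: power_add)
    qed (use q in simp)
  qed (use assms q in auto)
  moreover have "(\<Sum>a\<le>k. q ^ a) \<le> 1 / (1 - q)"
    unfolding sums_unique[OF geometric_sums[of q], simplified q]
    using q summable_geometric[of q] suminf_geometric[of q] sum_le_suminf[of "\<lambda>a. q ^ a" "{..k}"]
    by auto
  then have "2 * (q ^ K * (\<Sum>a\<le>k. q ^ a)) \<le> 2 * (q ^ K * (1 / (1 - q)))"
    using q by (intro mult_left_mono) auto
  ultimately have "(qpoch q (l - 1))\<^sup>2 / qpoch q (2 * l - 1) - 3 * \<delta> \<le>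
      (\<Sum>a\<le>k. ?h a) - 2 * (q ^ K * (\<Sum>a\<le>k. q ^ a))"
    using \<delta>(1) by simp
  also have "\<dots> = (\<Sum>a\<le>k. ?h a - 2 * (q ^ K * q ^ a))"
    by (simp only: sum_subtractf sum_distrib_left)
  finally have "(1 - \<delta>) * ((qpoch q (l - 1))\<^sup>2 / qpoch q (2 * l - 1) - 3 * \<delta>) \<le>
      (1 - \<delta>) * (\<Sum>a\<le>k. ?h a - 2 * (q ^ K * q ^ a))"
    using \<delta> by (intro mult_left_mono) auto
  also have "\<dots> = (\<Sum>a\<le>k. (1 - \<delta>) * (?h a - 2 * (q ^ K * q ^ a)))"
    by (rule sum_distrib_left)
  also have "\<dots> \<le> (\<Sum>a\<le>k. \<Sum>b\<le>j. position_term q l k j a b)"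
    using row by (intro sum_mono) auto
  finally show ?thesis .
qed

end

section \<open>Comparison with the bulk\<close>

text \<open>
  The value that \<open>position_mean q l k j\<close> approaches when \<open>k\<close> and \<open>j\<close> are both large.
\<close>

definition bulk_mean :: "real \<Rightarrow> nat \<Rightarrow> real" where
  "bulk_mean q l = qpoch q l * ((qpoch q (l - 1))\<^sup>2 / qpoch q (2 * l - 1))"

text \<open>
  The powers of \<open>1 - q\<close> in the \<open>q\<close>-factorials add up to \<open>l + 2 (l - 1) - (2 l - 1) = l - 1\<close>.
\<close>

lemma bulk_mean_eq_qfact:
  assumes "0 < q" "q < 1" "1 \<le> l"
  shows "bulk_mean q l = qfact q l * (qfact q (l - 1))\<^sup>2 / qfact q (2 * l - 1) * (1 - q) ^ (l - 1)"
proof -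
  define r where "r = l - 1"
  have r: "l - 1 = r" "l = Suc r" "2 * l - 1 = Suc (r + r)" using assms by (auto simp: r_def)
  have "1 - q \<noteq> 0" "qpoch q (Suc (r + r)) \<noteq> 0" using assms qpoch_pos[of q "Suc (r + r)"] by auto
  then show ?thesis
    unfolding bulk_mean_def qfact_def r(1,3)
    unfolding r(2) by (simp add: field_simps power_add power2_eq_square)
qed

lemma qpoch_ratio_le:
  assumes "0 < q" "q < 1" "q ^ K / (1 - q) \<le> \<delta>" "\<delta> \<le> 1 / 2" "K \<le> j"
  shows "qpoch q j / qpoch q (j + s) \<le> 1 / (1 - \<delta>)"
proof -
  have "q ^ j / (1 - q) \<le> q ^ K / (1 - q)"
    using assms by (intro divide_right_mono power_decreasing) auto
  with assms have "q ^ j / (1 - q) \<le> \<delta>" by simp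
  from qpoch_add_ge[OF assms(1,2) this, of s] show ?thesis
    using qpoch_pos[OF assms(1,2)] assms(4) by (simp add: field_simps)
qed

text \<open>
  At least one end is at distance \<open>K\<close> from the window, and by symmetry it may be taken to be the
  right one, so that the half-infinite bound applies.
\<close>

lemma position_mean_le_uniform:
  assumes "0 < q" "q < 1" "q ^ K / (1 - q) \<le> \<delta>" "\<delta> \<le> 1 / 2" "2 * K \<le> k + j" "1 \<le> l"
  shows "position_mean q l k j \<le> 2 * (fact l * (1 - q) ^ (l - 1))"
proof -
  have *: "position_mean q l k j \<le> 2 * (fact l * (1 - q) ^ (l - 1))" if "K \<le> j" for k j
  proof -
    let ?H = "qpoch q k / qpoch q (k + l) *
      (\<Sum>a\<le>k. q ^ (l * a) * (qpoch q (a + (l - 1)) / qpoch q a))"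
    note P = less_imp_le[OF qpoch_pos[OF assms(1,2)]]
    have "position_mean q l k j \<le> qpoch q l * (qpoch q j / qpoch q (k + j + l) * ?H)"
      unfolding position_mean_def using assms P by (intro mult_left_mono sum_position_term_le) auto
    also have "\<dots> = qpoch q j / qpoch q (j + (k + l)) * (qpoch q l * ?H)"
      by (simp only: mult.left_commute add.assoc add.left_commute)
    also have "\<dots> \<le> 2 * (fact l * (1 - q) ^ (l - 1))"
    proof (rule mult_mono)
      show "qpoch q l * ?H \<le> fact l * (1 - q) ^ (l - 1)"
        using assms by (intro half_infinite_mean_le)
      have "1 / (1 - \<delta>) \<le> 2" using assms by (simp add: field_simps)
      then show "qpoch q j / qpoch q (j + (k + l)) \<le> 2"
        using qpoch_ratio_le[OF assms(1-4) that, of "k + l"] by linarith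
    qed (use assms P in \<open>auto intro!: mult_nonneg_nonneg sum_nonneg divide_nonneg_nonneg\<close>)
    finally show ?thesis .
  qed
  show ?thesis
  proof (cases "K \<le> j")
    case False
    then have "K \<le> k" using assms by simp
    from *[OF this, of j] show ?thesis by (simp only: position_mean_commute[of q l k j])
  qed (rule *)
qed

lemma position_mean_le_bulk_mean:
  assumes "0 < q" "q < 1" "q ^ K / (1 - q) \<le> \<delta>" "\<delta> \<le> 1 / 2" "K \<le> k" "K \<le> j" "1 \<le> l"
  shows "position_mean q l k j \<le> bulk_mean q l / (1 - \<delta>)\<^sup>2"
proof -
  let ?h = "\<lambda>a. q ^ (l * a) * (qpoch q (a + (l - 1)) / qpoch q a)"
  let ?D = "(qpoch q (l - 1))\<^sup>2 / qpoch q (2 * l - 1)"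
  note P = less_imp_le[OF qpoch_pos[OF assms(1,2)]]
  have h0: "0 \<le> ?h a" for a using assms P by (intro mult_nonneg_nonneg divide_nonneg_nonneg) auto
  note h = sums_position_term_outer[OF assms(1,2,7)]
  have sum_le: "(\<Sum>a\<le>k. ?h a) \<le> ?D"
    unfolding sums_unique[OF h] using h0 sums_summable[OF h] by (intro sum_le_suminf) auto
  have "qpoch q k / qpoch q (k + l) \<le> 1 / (1 - \<delta>)"
    using assms by (intro qpoch_ratio_le)
  from mult_mono[OF this sum_le] have half: "qpoch q k / qpoch q (k + l) * (\<Sum>a\<le>k. ?h a) \<le> 1 / (1 - \<delta>) * ?D"
    using assms h0 by (simp add: sum_nonneg)
  have "qpoch q j / qpoch q (j + (k + l)) \<le> 1 / (1 - \<delta>)"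
    using assms by (intro qpoch_ratio_le)
  from mult_mono[OF this half] have "qpoch q j / qpoch q (j + (k + l)) * (qpoch q k / qpoch q (k + l) * (\<Sum>a\<le>k. ?h a)) \<le>
      1 / (1 - \<delta>) * (1 / (1 - \<delta>) * ?D)"
    using assms P h0 by (simp add: sum_nonneg)
  then have "qpoch q l * (\<Sum>a\<le>k. \<Sum>b\<le>j. position_term q l k j a b) \<le>
      qpoch q l * (1 / (1 - \<delta>) * (1 / (1 - \<delta>) * ?D))"
    using sum_position_term_le[OF assms(1,2,7), of k j] P
    by (intro mult_left_mono) (auto simp: add_ac)
  then show ?thesis
    unfolding position_mean_def bulk_mean_def by (simp add: power2_eq_square mult_ac)
qed

lemma position_mean_ge_bulk_mean:
  assumes "0 < q" "q < 1" "q ^ K / (1 - q) \<le> \<delta>" "\<delta> \<le> 1 / 2" "K \<le> k" "2 * K \<le> j" "2 \<le> l"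
  shows "(1 - \<delta>) * (bulk_mean q l - 3 * (qpoch q l * \<delta>)) \<le> position_mean q l k j"
proof -
  have "qpoch q l * ((1 - \<delta>) * ((qpoch q (l - 1))\<^sup>2 / qpoch q (2 * l - 1) - 3 * \<delta>)) \<le> position_mean q l k j"
    unfolding position_mean_def using assms less_imp_le[OF qpoch_pos[OF assms(1,2)]]
    by (intro mult_left_mono sum_position_term_ge) auto
  then show ?thesis
    unfolding bulk_mean_def by (simp add: algebra_simps)
qed

text \<open>
  All but at most \<open>4 K\<close> windows have distance at least \<open>2 K\<close> from both ends and contribute the bulk value
  up to errors that vanish with \<open>\<delta>\<close>. The others are bounded uniformly in the upper bound and dropped in
  the lower one.
\<close>

lemma expectation_Arr_bounds:
  assumes q: "0 < q" "q < 1" and \<delta>: "q ^ K / (1 - q) \<le> \<delta>" "\<delta> \<le> 1 / 2"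
    and n: "l + 4 * K \<le> n" and l: "2 \<le> l"
  defines "E \<equiv> measure_pmf.expectation (mallows n q) (\<lambda>\<pi>. real (Arr n l (Perms l) \<pi>))"
  shows "E \<le> real n * (bulk_mean q l / (1 - \<delta>)\<^sup>2) + 8 * real K * (fact l * (1 - q) ^ (l - 1))"
    and "(real n - real l + 1 - 4 * real K) * ((1 - \<delta>) * (bulk_mean q l - 3 * (qpoch q l * \<delta>))) \<le> E"
proof -
  define m where "m = n - l"
  have m: "4 * K \<le> m" "n = m + l" using n by (auto simp: m_def)
  note P = less_imp_le[OF qpoch_pos[OF q]]
  have E: "E = (\<Sum>k\<le>m. position_mean q l k (m - k))"
    unfolding E_def m_def using q n by (intro expectation_Arr_eq_sum_position_mean) auto
  let ?F = "2 * (fact l * (1 - q) ^ (l - 1))"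
  let ?B = "{..<2 * K} \<union> {m - 2 * K<..m}"
  have F0: "0 \<le> ?F" using q by simp
  have lim0: "0 \<le> bulk_mean q l / (1 - \<delta>)\<^sup>2"
    unfolding bulk_mean_def using P by simp
  have "E \<le> (\<Sum>k\<le>m. bulk_mean q l / (1 - \<delta>)\<^sup>2 + of_bool (k \<in> ?B) * ?F)"
    unfolding E
  proof (rule sum_mono)
    fix k assume k: "k \<in> {..m}"
    show "position_mean q l k (m - k) \<le> bulk_mean q l / (1 - \<delta>)\<^sup>2 + of_bool (k \<in> ?B) * ?F"
    proof (cases "k \<in> ?B")
      case True
      have "position_mean q l k (m - k) \<le> ?F"
        using k m l by (intro position_mean_le_uniform[OF q \<delta>]) auto
      with True lim0 show ?thesis by simp
    next
      case False
      then have "position_mean q l k (m - k) \<le> bulk_mean q l / (1 - \<delta>)\<^sup>2"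
        using k m l by (intro position_mean_le_bulk_mean[OF q \<delta>]) auto
      then show ?thesis
        by (simp only: False of_bool_eq mult_zero_left add_0_right)
    qed
  qed
  also have "\<dots> = real (m + 1) * (bulk_mean q l / (1 - \<delta>)\<^sup>2) + real (card ({..m} \<inter> ?B)) * ?F"
    by (simp only: sum.distrib sum_distrib_right[symmetric] sum_of_bool_eq finite_atMost
        Collect_mem_eq sum_constant card_atMost Suc_eq_plus1)
  also have "\<dots> \<le> real n * (bulk_mean q l / (1 - \<delta>)\<^sup>2) + real (4 * K) * ?F"
  proof (intro add_mono mult_right_mono F0 lim0)
    show "real (m + 1) \<le> real n" using m l by simp
    have "card ({..m} \<inter> ?B) \<le> card ?B" by (intro card_mono) auto
    also have "\<dots> \<le> card {..<2 * K} + card {m - 2 * K<..m}" by (rule card_Un_le)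
    also have "\<dots> \<le> 4 * K" using m by simp
    finally show "real (card ({..m} \<inter> ?B)) \<le> real (4 * K)" by simp
  qed
  finally show "E \<le> real n * (bulk_mean q l / (1 - \<delta>)\<^sup>2) + 8 * real K * (fact l * (1 - q) ^ (l - 1))"
    by simp
  have "real (card {2 * K..m - 2 * K}) * ((1 - \<delta>) * (bulk_mean q l - 3 * (qpoch q l * \<delta>))) =
      (\<Sum>k\<in>{2 * K..m - 2 * K}. (1 - \<delta>) * (bulk_mean q l - 3 * (qpoch q l * \<delta>)))"
    by simp
  also have "\<dots> \<le> (\<Sum>k\<in>{2 * K..m - 2 * K}. position_mean q l k (m - k))"
    using m l by (intro sum_mono position_mean_ge_bulk_mean[OF q \<delta>]) auto
  also have "\<dots> \<le> (\<Sum>k\<le>m. position_mean q l k (m - k))"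
    using P position_term_nonneg[OF q] unfolding position_mean_def
    by (intro sum_mono2 mult_nonneg_nonneg sum_nonneg) auto
  also have "real (card {2 * K..m - 2 * K}) = real n - real l + 1 - 4 * real K"
    using m by (simp add: of_nat_diff)
  finally show "(real n - real l + 1 - 4 * real K) *
      ((1 - \<delta>) * (bulk_mean q l - 3 * (qpoch q l * \<delta>))) \<le> E"
    unfolding E .
qed

section \<open>Asymptotics\<close>

text \<open>
  The quotient \<open>(1 - q^t) / (1 - q)\<close> is the sum \<open>1 + q + \<dots> + q^(t - 1)\<close>, which tends to \<open>t\<close>.
\<close>

lemma tendsto_qfact:
  fixes q :: "'a \<Rightarrow> real"
  assumes "(q \<longlongrightarrow> 1) F" "eventually (\<lambda>x. q x \<noteq> 1) F"
  shows "((\<lambda>x. qfact (q x) n) \<longlongrightarrow> fact n) F"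
proof (induction n)
  case 0
  show ?case by (simp add: qfact_def)
next
  case (Suc n)
  have "((\<lambda>x. \<Sum>i<Suc n. q x ^ i) \<longlongrightarrow> (\<Sum>i<Suc n. 1 ^ i)) F"
    by (intro tendsto_sum tendsto_power assms)
  then have "((\<lambda>x. qfact (q x) n * (\<Sum>i<Suc n. q x ^ i)) \<longlongrightarrow> fact n * real (Suc n)) F"
    by (intro tendsto_mult Suc.IH) simp
  moreover have "eventually (\<lambda>x. qfact (q x) n * (\<Sum>i<Suc n. q x ^ i) = qfact (q x) (Suc n)) F"
    using assms(2)
  proof eventually_elim
    case (elim x)
    then show ?case
      by (subst sum_gp_strict) (simp add: qfact_def qpoch_Suc mult_ac)
  qed
  ultimately have "((\<lambda>x. qfact (q x) (Suc n)) \<longlongrightarrow> fact n * real (Suc n)) F"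
    by (rule Lim_transform_eventually)
  then show ?case by (simp add: mult.commute)
qed

theorem corollary2p2:
  fixes l :: nat and q :: "nat \<Rightarrow> real"
  assumes "l \<ge> 2"
    and "\<And>n. n \<ge> 1 \<Longrightarrow> q n \<in> {0<..<1}"
    and "(\<lambda>n. 1 - q n) \<in> o[sequentially](\<lambda>_. 1)"
    and "filterlim (\<lambda>n. (1 - q n) * real n / ln (real n)) at_top sequentially"
  shows "(\<lambda>n. measure_pmf.expectation (mallows n (q n)) (\<lambda>\<pi>. real (Arr n l (Perms l) \<pi>)))
           \<sim>[sequentially]
         (\<lambda>n. fact l * (fact (l - 1))\<^sup>2 / fact (2 * l - 1) * real n * (1 - q n) ^ (l - 1))"
proof -
  \<comment> \<open>The cut-off makes \<open>q^K\<close> at most \<open>n^(-2)\<close>, which beats \<open>1 / (1 - q) \<le> n\<close>.\<close>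
  define K where "K n = nat \<lceil>2 * ln (real n) / (1 - q n)\<rceil>" for n
  define c :: real where "c = fact l * (fact (l - 1))\<^sup>2 / fact (2 * l - 1)"
  define Ex where "Ex n = measure_pmf.expectation (mallows n (q n)) (\<lambda>\<pi>. real (Arr n l (Perms l) \<pi>))" for n
  \<comment> \<open>The bulk value without its factor \<open>(1 - q)^(l - 1)\<close>.\<close>
  define C where "C n = qfact (q n) l * (qfact (q n) (l - 1))\<^sup>2 / qfact (q n) (2 * l - 1)" for n
  have c: "c > 0" by (simp add: c_def)
  have ev_q: "eventually (\<lambda>n. 0 < q n \<and> q n < 1) sequentially"
    using eventually_ge_at_top[of 1] by eventually_elim (use assms(2) in auto)
  have p0: "(\<lambda>n. 1 - q n) \<longlonglongrightarrow> 0"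
    using smalloD_tendsto[OF assms(3)] by simp
  have q1: "q \<longlonglongrightarrow> 1"
    using tendsto_diff[OF tendsto_const[of 1] p0] by simp
  have qf: "(\<lambda>n. qfact (q n) i) \<longlonglongrightarrow> fact i" for i
    by (rule tendsto_qfact[OF q1]) (use ev_q in \<open>auto elim: eventually_mono\<close>)
  have C: "C \<longlonglongrightarrow> c"
    unfolding C_def c_def by (intro tendsto_intros qf) simp
  have ev_ln: "eventually (\<lambda>n. 1 \<le> (1 - q n) * real n / ln (real n) \<and> 1 \<le> ln (real n)) sequentially"
  proof (rule eventually_conj)
    show "eventually (\<lambda>n. 1 \<le> (1 - q n) * real n / ln (real n)) sequentially"
      using assms(4) by (simp add: filterlim_at_top)
    show "eventually (\<lambda>n. 1 \<le> ln (real n)) sequentially"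
      by real_asymp
  qed
  have Kn: "(\<lambda>n. real (K n) / real n) \<longlonglongrightarrow> 0"
  proof (rule tendsto_sandwich[where f = "\<lambda>_. 0"])
    have "(\<lambda>n. inverse ((1 - q n) * real n / ln (real n))) \<longlonglongrightarrow> 0"
      using assms(4) by (rule tendsto_inverse_0_at_top)
    moreover have "(\<lambda>n. 1 / real n) \<longlonglongrightarrow> 0" by real_asymp
    ultimately have "(\<lambda>n. 2 * inverse ((1 - q n) * real n / ln (real n)) + 1 / real n) \<longlonglongrightarrow> 2 * 0 + 0"
      by (intro tendsto_add tendsto_mult tendsto_const)
    then show "(\<lambda>n. 2 * inverse ((1 - q n) * real n / ln (real n)) + 1 / real n) \<longlonglongrightarrow> 0"
      by simp
    show "eventually (\<lambda>n. real (K n) / real n \<le>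
        2 * inverse ((1 - q n) * real n / ln (real n)) + 1 / real n) sequentially"
      using ev_q ev_ln eventually_gt_at_top[of 0]
    proof eventually_elim
      case (elim n)
      have "0 \<le> 2 * ln (real n) / (1 - q n)" using elim by simp
      then have "real (K n) \<le> 2 * ln (real n) / (1 - q n) + 1"
        unfolding K_def by linarith
      then have "real (K n) / real n \<le> (2 * ln (real n) / (1 - q n) + 1) / real n"
        by (intro divide_right_mono) auto
      also have "\<dots> = 2 * inverse ((1 - q n) * real n / ln (real n)) + 1 / real n"
        by (simp add: add_divide_distrib)
      finally show ?case .
    qed
  qed auto
  have ev_\<delta>: "eventually (\<lambda>n. q n ^ K n / (1 - q n) \<le> 1 / real n) sequentially"
    using ev_q ev_ln eventually_gt_at_top[of 0]
  proof eventually_elim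
    case (elim n)
    have p: "0 < 1 - q n" and n: "0 < real n" using elim by auto
    have "q n ^ K n \<le> exp (- (1 - q n)) ^ K n"
      using exp_ge_add_one_self[of "- (1 - q n)"] elim by (intro power_mono) auto
    also have "\<dots> = exp (- (real (K n) * (1 - q n)))"
      by (simp only: exp_of_nat_mult[symmetric] mult_minus_right)
    also have "\<dots> \<le> exp (- (2 * ln (real n)))"
    proof -
      have "2 * ln (real n) / (1 - q n) \<le> real (K n)"
        unfolding K_def by linarith
      then show ?thesis using p by (simp add: field_simps)
    qed
    also have "\<dots> = 1 / (real n * real n)"
    proof -
      have "exp (2 * ln (real n)) = exp (ln (real n)) * exp (ln (real n))"
        by (simp only: mult_2 exp_add)
      then show ?thesis using n by (simp add: exp_minus inverse_eq_divide)
    qed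
    finally have "q n ^ K n / (1 - q n) \<le> 1 / (real n * real n) / (1 - q n)"
      using p by (intro divide_right_mono) auto
    also have "\<dots> = 1 / (real n * (real n * (1 - q n)))" by simp
    also have "\<dots> \<le> 1 / (real n * 1)"
    proof (intro divide_left_mono mult_left_mono)
      have "0 < ln (real n)" using elim by linarith
      moreover from this have "ln (real n) \<le> (1 - q n) * real n"
        using elim by (simp add: field_simps)
      ultimately show "1 \<le> real n * (1 - q n)" using elim by (simp add: mult.commute)
    qed (use p n in auto)
    finally show ?case by simp
  qed
  have ev_n: "eventually (\<lambda>n. l + 4 * K n \<le> n) sequentially"
  proof -
    have "(\<lambda>n. real l / real n) \<longlonglongrightarrow> 0" by real_asymp
    then have "(\<lambda>n. real l / real n + 4 * (real (K n) / real n)) \<longlonglongrightarrow> 0 + 4 * 0"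
      by (intro tendsto_add tendsto_mult tendsto_const Kn)
    then have "eventually (\<lambda>n. real l / real n + 4 * (real (K n) / real n) < 1) sequentially"
      by (intro order_tendstoD(2)[of _ "0 + 4 * 0"]) auto
    then show ?thesis
      using eventually_gt_at_top[of 0]
    proof eventually_elim
      case (elim n)
      then have "real l + 4 * real (K n) < real n" by (simp add: field_simps)
      then show ?case by linarith
    qed
  qed
  \<comment> \<open>The bounds \<open>?L\<close> and \<open>?U\<close> are those of \<open>expectation_Arr_bounds\<close> with \<open>\<delta> = 1 / n\<close>, divided by \<open>?G\<close>.\<close>
  let ?G = "\<lambda>n. c * real n * (1 - q n) ^ (l - 1)"
  let ?U = "\<lambda>n. C n / (1 - 1 / real n)\<^sup>2 / c + 8 * fact l / c * (real (K n) / real n)"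
  let ?L = "\<lambda>n. (1 - real l / real n + 1 / real n - 4 * (real (K n) / real n)) * ((1 - 1 / real n) *
      (C n - 3 * (qfact (q n) l * (1 - q n) * (1 / real n)))) / c"
  have n0: "(\<lambda>n. 1 / real n) \<longlonglongrightarrow> 0" "(\<lambda>n. real l / real n) \<longlonglongrightarrow> 0" by real_asymp+
  have "(\<lambda>n. Ex n / ?G n) \<longlonglongrightarrow> 1"
  proof (rule tendsto_sandwich[where f = ?L and h = ?U])
    have "?U \<longlonglongrightarrow> c / (1 - 0)\<^sup>2 / c + 8 * fact l / c * 0"
      using c by (intro tendsto_intros C Kn n0) auto
    then show "?U \<longlonglongrightarrow> 1" using c by simp
    have "?L \<longlonglongrightarrow> (1 - 0 + 0 - 4 * 0) * ((1 - 0) * (c - 3 * (fact l * 0 * 0))) / c"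
      using c by (intro tendsto_intros C Kn n0 qf p0) auto
    then show "?L \<longlonglongrightarrow> 1" using c by simp
    have both: "eventually (\<lambda>n. ?L n \<le> Ex n / ?G n \<and> Ex n / ?G n \<le> ?U n) sequentially"
      using ev_q ev_\<delta> ev_n eventually_ge_at_top[of 2]
    proof eventually_elim
      case (elim n)
      define p where "p = (1 - q n) ^ (l - 1)"
      have p: "0 < p" and n: "0 < real n" using elim by (auto simp: p_def)
      have lim: "bulk_mean (q n) l = C n * p"
        unfolding C_def p_def using elim assms(1) by (intro bulk_mean_eq_qfact) auto
      have ql: "qpoch (q n) l = qfact (q n) l * (1 - q n) * p"
      proof -
        have "(1 - q n) * p = (1 - q n) ^ l"
          unfolding p_def using assms(1) by (cases l) auto
        then show ?thesis using elim by (simp only: mult.assoc) (simp add: qfact_def)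
      qed
      have half: "1 / real n \<le> 1 / 2" using elim by simp
      note b = expectation_Arr_bounds[OF _ _ elim(2) half elim(3) assms(1), folded Ex_def,
          unfolded lim ql, folded p_def]
      have G: "?G n > 0" using c p n by (simp add: p_def)
      have "?L n * ?G n = (real n - real l + 1 - 4 * real (K n)) * ((1 - 1 / real n) *
          (C n * p - 3 * (qfact (q n) l * (1 - q n) * p * (1 / real n))))"
      proof -
        have "(1 - real l / real n + 1 / real n - 4 * (real (K n) / real n)) * real n =
            real n - real l + 1 - 4 * real (K n)"
          using n by (simp add: field_simps)
        moreover have "(C n - 3 * (qfact (q n) l * (1 - q n) * (1 / real n))) * p =
            C n * p - 3 * (qfact (q n) l * (1 - q n) * p * (1 / real n))"
          by (simp add: algebra_simps)
        moreover have "x * (y * z) / c * (c * w * v) = (x * w) * (y * (z * v))" for x y z w v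
          using c by simp
        ultimately show ?thesis unfolding p_def[symmetric] by (simp only:)
      qed
      also have "\<dots> \<le> Ex n" using b(2) elim by simp
      finally have "?L n \<le> Ex n / ?G n" using G by (simp only: pos_le_divide_eq)
      moreover have "Ex n \<le> ?U n * ?G n"
      proof -
        have "Ex n \<le> real n * (C n * p / (1 - 1 / real n)\<^sup>2) + 8 * real (K n) * (fact l * p)"
          using b(1) elim by simp
        also have "\<dots> = ?U n * ?G n"
        proof -
          have "(x / y / c + 8 * z / c * (k / real n)) * (c * real n * p) =
              real n * (x * p / y) + 8 * k * (z * p)" for x y z k
            using c n by (simp add: field_simps)
          then show ?thesis unfolding p_def[symmetric] by (simp only:)
        qed
        finally show ?thesis .
      qed
      then have "Ex n / ?G n \<le> ?U n" using G by (simp only: pos_divide_le_eq)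
      ultimately show ?case ..
    qed
    then show "eventually (\<lambda>n. ?L n \<le> Ex n / ?G n) sequentially"
      by eventually_elim simp
    from both show "eventually (\<lambda>n. Ex n / ?G n \<le> ?U n) sequentially"
      by eventually_elim simp
  qed
  then show ?thesis
    unfolding Ex_def c_def by (rule asymp_equivI')
qed

end
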